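(* Let $z$ range over a finite-dimensional smooth manifold, let $\mathcal S$ be a finite-dimensional smooth manifold with points $\sigma$, and let $E:(z,\sigma)\mapsto E(z,\sigma)\in\mathbb R$. Assume that for some $r\ge2$: (i) $E$ is $C^{r+1}$; (ii) $E$ is locally uniformly inf-compact in $\sigma$, i.e. for every compact set $K$ of parameters $z$ and every $c\in\mathbb R$ the set $\{\sigma\in\mathcal S:\exists z\in K,\ E(z,\sigma)\le c\}$ is relatively compact in $\mathcal S$; (iii) for every $z$ the function $E(z,\cdot)$ has a unique interior minimizer $\sigma_\star(z)$ over $\mathcal S$; and (iv) $H(z):=E_{\sigma\sigma}(z,\sigma_\star(z))$ is positive definite. Then the minimizer section and the reduced energy $$\sigma_\star(z)=\operatorname*{arg\,min}_\sigma E(z,\sigma),\qquad \bar E(z)=E(z,\sigma_\star(z))$$ are $C^r$. In local coordinates, with all derivatives of $E$ evaluated at $(z,\sigma_\star(z))$, $$D_z\sigma_\star=-H^{-1}E_{\sigma z},\qquad D_z\bar E=E_z,\qquad D^2_{zz}\bar E=E_{zz}-E_{z\sigma}H^{-1}E_{\sigma z}.$$ If the hidden coordinate is split as $\sigma=(\alpha,\beta)$, let $\mathbb H$ denote the full Hessian of $E$ in $(z,\alpha,\beta)$ at $(z,\sigma_\star(z))$. When its joint hidden block (the $(\alpha,\beta)$ block) is positive definite, sequential and joint second-order elimination agree: $$\operatorname{Schur}_{(\alpha,\beta)}\mathbb H=\operatorname{Schur}_\alpha\bigl(\operatorname{Schur}_\beta\mathbb H\bigr).$$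
   Context: Subscripts denote partial derivatives in local coordinates for $z$ and $\sigma$ (so $E_{\sigma z}$ is the mixed second derivative block and $E_{z\sigma}$ its transpose). For a symmetric block matrix (quadratic form) in variables $(w,\eta)$ with positive definite $\eta$-block, $\operatorname{Schur}_\eta$ denotes the Schur complement eliminating $\eta$: $\mathbb H_{ww}-\mathbb H_{w\eta}\mathbb H_{\eta\eta}^{-1}\mathbb H_{\eta w}$. *)

theory Defs
  imports "HOL-Analysis.Analysis"
begin

section \<open>Functions of class C^k on open sets\<close>

text \<open>The domain is finite-dimensional, so C^k can be expressed by directional derivatives of the
  Frechet derivative. Only meant for open \<open>S\<close>.\<close>

primrec Ck_on :: "nat \<Rightarrow> 'a::euclidean_space set \<Rightarrow> ('a \<Rightarrow> 'b::real_normed_vector) \<Rightarrow> bool" where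
  "Ck_on 0 S f \<longleftrightarrow> continuous_on S f"
| "Ck_on (Suc k) S f \<longleftrightarrow>
     (\<forall>x\<in>S. f differentiable (at x)) \<and> (\<forall>v. Ck_on k S (\<lambda>x. frechet_derivative f (at x) v))"


section \<open>Smooth manifolds\<close>

text \<open>A chart is a pair of its domain and its coordinate map; the coordinate map is irrelevant
  outside the domain.\<close>

type_synonym ('m, 'e) chart = "'m set \<times> ('m \<Rightarrow> 'e)"

definition chart_inv :: "('m, 'e) chart \<Rightarrow> 'e \<Rightarrow> 'm" where
  "chart_inv c = inv_into (fst c) (snd c)"

definition is_chart :: "('m::topological_space, 'e::euclidean_space) chart \<Rightarrow> bool" where
  "is_chart c \<longleftrightarrow> open (fst c) \<and> open (snd c ` fst c) \<and>
     homeomorphism (fst c) (snd c ` fst c) (snd c) (chart_inv c)"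

definition local_rep ::
  "('m, 'e) chart \<Rightarrow> ('n, 'f) chart \<Rightarrow> ('m \<Rightarrow> 'n) \<Rightarrow> 'e \<Rightarrow> 'f" where
  "local_rep c d f = snd d \<circ> f \<circ> chart_inv c"

text \<open>Atlases are not required to be maximal. A maximal atlas is a special case, so statements
  about all charts of an arbitrary smooth atlas cover all local coordinates.\<close>

definition smooth_atlas :: "('m::topological_space, 'e::euclidean_space) chart set \<Rightarrow> bool" where
  "smooth_atlas A \<longleftrightarrow>
     (\<forall>c\<in>A. is_chart c) \<and> (\<Union>c\<in>A. fst c) = UNIV \<and>
     (\<forall>c\<in>A. \<forall>d\<in>A. \<forall>k. Ck_on k (snd c ` (fst c \<inter> fst d)) (local_rep c d (\<lambda>x. x)))"

definition prod_chart :: "('m, 'e) chart \<Rightarrow> ('n, 'f) chart \<Rightarrow> ('m \<times> 'n, 'e \<times> 'f) chart" where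
  "prod_chart c d = (fst c \<times> fst d, map_prod (snd c) (snd d))"

definition prod_atlas ::
  "('m, 'e) chart set \<Rightarrow> ('n, 'f) chart set \<Rightarrow> ('m \<times> 'n, 'e \<times> 'f) chart set" where
  "prod_atlas A B = {prod_chart c d |c d. c \<in> A \<and> d \<in> B}"

definition id_chart :: "('e, 'e) chart" where
  "id_chart = (UNIV, \<lambda>x. x)"

definition Ck_map ::
  "nat \<Rightarrow> ('m::topological_space, 'e::euclidean_space) chart set \<Rightarrow>
   ('n::topological_space, 'f::euclidean_space) chart set \<Rightarrow> ('m \<Rightarrow> 'n) \<Rightarrow> bool" where
  "Ck_map k A B f \<longleftrightarrow> continuous_on UNIV f \<and>
     (\<forall>c\<in>A. \<forall>d\<in>B. Ck_on k (snd c ` (fst c \<inter> f -` fst d)) (local_rep c d f))"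


section \<open>Derivatives in coordinates\<close>

definition gradient :: "(real^'n \<Rightarrow> real) \<Rightarrow> real^'n \<Rightarrow> real^'n" where
  "gradient f x = (\<chi> i. frechet_derivative f (at x) (axis i 1))"

definition hessian :: "(real^'n \<Rightarrow> real) \<Rightarrow> real^'n \<Rightarrow> real^'n^'n" where
  "hessian f x = jacobian (gradient f) (at x)"

text \<open>Partial derivatives of a function \<open>F\<close> of two coordinate vectors \<open>x\<close> (visible, \<open>z\<close>) and
  \<open>y\<close> (hidden, \<open>\<sigma>\<close>). The entry of \<open>E_sz\<close> in row \<open>i\<close> and column \<open>j\<close> is the derivative along \<open>x $ j\<close>
  of the derivative along \<open>y $ i\<close>.\<close>

definition E_z :: "((real^'z) \<times> (real^'s) \<Rightarrow> real) \<Rightarrow> real^'z \<Rightarrow> real^'s \<Rightarrow> real^'z" where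
  "E_z F x y = gradient (\<lambda>x. F (x, y)) x"

definition E_zz :: "((real^'z) \<times> (real^'s) \<Rightarrow> real) \<Rightarrow> real^'z \<Rightarrow> real^'s \<Rightarrow> real^'z^'z" where
  "E_zz F x y = hessian (\<lambda>x. F (x, y)) x"

definition E_ss :: "((real^'z) \<times> (real^'s) \<Rightarrow> real) \<Rightarrow> real^'z \<Rightarrow> real^'s \<Rightarrow> real^'s^'s" where
  "E_ss F x y = hessian (\<lambda>y. F (x, y)) y"

definition E_sz :: "((real^'z) \<times> (real^'s) \<Rightarrow> real) \<Rightarrow> real^'z \<Rightarrow> real^'s \<Rightarrow> real^'z^'s" where
  "E_sz F x y = jacobian (\<lambda>x. gradient (\<lambda>y. F (x, y)) y) (at x)"

definition E_zs :: "((real^'z) \<times> (real^'s) \<Rightarrow> real) \<Rightarrow> real^'z \<Rightarrow> real^'s \<Rightarrow> real^'s^'z" where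
  "E_zs F x y = transpose (E_sz F x y)"

definition join :: "real^'z \<Rightarrow> real^'s \<Rightarrow> real^('z + 's)" where
  "join x y = (\<chi> k. case k of Inl i \<Rightarrow> x $ i | Inr j \<Rightarrow> y $ j)"

definition full_hessian ::
  "((real^'z) \<times> (real^'s) \<Rightarrow> real) \<Rightarrow> real^'z \<Rightarrow> real^'s \<Rightarrow> real^('z + 's)^('z + 's)" where
  "full_hessian F x y =
     hessian (\<lambda>u. F (\<chi> i. u $ Inl i, \<chi> j. u $ Inr j)) (join x y)"


section \<open>Schur complements\<close>

text \<open>Symmetry is not part of the definition; it is automatic for the Hessians it is applied to.\<close>

definition pos_def :: "real^'n^'n \<Rightarrow> bool" where
  "pos_def M \<longleftrightarrow> (\<forall>v. v \<noteq> 0 \<longrightarrow> v \<bullet> (M *v v) > 0)"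

text \<open>Groups of variables are selected by injections \<open>p\<close>, \<open>q\<close> into the index type.\<close>

definition block :: "('i \<Rightarrow> 'n) \<Rightarrow> ('j \<Rightarrow> 'n) \<Rightarrow> real^'n^'n \<Rightarrow> real^'j^'i" where
  "block p q M = (\<chi> i j. M $ p i $ q j)"

text \<open>\<open>schur w h M\<close> eliminates the variables \<open>h\<close> and keeps the variables \<open>w\<close>.\<close>

definition schur :: "('w \<Rightarrow> 'n) \<Rightarrow> ('h::finite \<Rightarrow> 'n) \<Rightarrow> real^'n^'n \<Rightarrow> real^'w^'w" where
  "schur w h M = block w w M - block w h M ** matrix_inv (block h h M) ** block h w M"


section \<open>Energies and minimizers\<close>

definition locally_uniformly_inf_compact ::
  "('m::topological_space \<times> 's::topological_space \<Rightarrow> real) \<Rightarrow> bool" where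
  "locally_uniformly_inf_compact E \<longleftrightarrow>
     (\<forall>K c. compact K \<longrightarrow> compact (closure {s. \<exists>z\<in>K. E (z, s) \<le> c}))"

definition minimizer :: "('m \<times> 's \<Rightarrow> real) \<Rightarrow> 'm \<Rightarrow> 's" where
  "minimizer E z = (ARG_MIN (\<lambda>s. E (z, s)) s. True)"

definition reduced_energy :: "('m \<times> 's \<Rightarrow> real) \<Rightarrow> 'm \<Rightarrow> real" where
  "reduced_energy E z = E (z, minimizer E z)"

end

theory Submission
  imports Defs
begin

text \<open>The minimizer depends continuously on the parameter because of inf-compactness. For parameters near
\<open>z\<^sub>0\<close> the minimal energy stays below the constant \<open>E (z\<^sub>0, s\<^sub>0) + 1\<close>, where \<open>s\<^sub>0\<close> is the minimizer at
\<open>z\<^sub>0\<close>, so all these minimizers lie in one compact set \<open>C\<close>. If \<open>V\<close> is an open neighbourhood of \<open>s\<^sub>0\<close>,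
the points of the compact set \<open>C - V\<close> have larger energy than \<open>s\<^sub>0\<close> at the parameter \<open>z\<^sub>0\<close>, by
uniqueness, and by the tube lemma still at nearby parameters; so nearby minimizers lie in \<open>V\<close>
(\<open>continuous_minimizer\<close>).

Everything else is local. In charts the minimizer is a continuous function \<open>g\<close> whose graph solves
\<open>G (x, g x) = 0\<close>, where \<open>G\<close> is the gradient of the energy in the hidden variables. As \<open>g\<close> is already
known to exist and to be continuous, its derivative can be read off: expanding \<open>G\<close> to first
order at a point of the graph and inverting the Hessian block \<open>H\<close> gives \<open>D g = - H\<^sup>-\<^sup>1 E\<^sub>\<sigma>\<^sub>z\<close>
(\<open>has_derivative_implicit\<close>). The right-hand side is a C^(r-1) function of \<open>(x, g x)\<close>, so if \<open>g\<close> is C^k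
with \<open>k < r\<close>, then its derivative is C^k and \<open>g\<close> is C^(k+1); starting from continuity one reaches C^r
(\<open>Ck_on_section\<close>). That the inverse matrix preserves smoothness is Cramer's rule
(\<open>Ck_on_linear_solution\<close>).

The chain rule gives the derivatives of \<open>e x = F (x, g x)\<close>. The hidden gradient vanishes on the graph,
so the gradient of \<open>e\<close> is the visible partial gradient of \<open>F\<close> at \<open>(x, g x)\<close>; differentiating once more
and using the symmetry of second derivatives gives the Hessian.

The elimination formula is linear algebra. Eliminating hidden variables means
solving a linear system with the hidden block as matrix, and this system may be solved by
substitution, first for one group of unknowns and then for the other (\<open>schur_sequential\<close>).\<close>

section \<open>Calculus of C^k functions\<close>

lemma Ck_on_cong:
  assumes "open S" "\<And>x. x \<in> S \<Longrightarrow> f x = g x" "Ck_on k S f"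
  shows "Ck_on k S g"
  using assms(2,3)
proof (induction k arbitrary: f g)
  case 0
  then show ?case by (simp cong: continuous_on_cong)
next
  case (Suc k)
  have "g differentiable at x" if "x \<in> S" for x
    using Suc.prems(1) Ck_on.simps(2)[THEN iffD1, OF Suc.prems(2)] that
      has_derivative_transform_within_open[OF _ assms(1) that]
    unfolding differentiable_def by blast
  moreover have "Ck_on k S (\<lambda>x. frechet_derivative g (at x) v)" for v
  proof (rule Suc.IH)
    show "Ck_on k S (\<lambda>x. frechet_derivative f (at x) v)"
      using Suc.prems by simp
    show "frechet_derivative f (at x) v = frechet_derivative g (at x) v" if "x \<in> S" for x
      using frechet_derivative_transform_within_open[of f x S g] Suc.prems assms(1) that by simp
  qed
  ultimately show ?case by simp
qed

text \<open>The definition of \<open>Ck_on\<close> speaks about \<open>frechet_derivative\<close>; this rule allows any explicit formula for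
  the derivative instead, which the inductive proofs of closure properties supply from the rules for
  derivatives.\<close>

lemma Ck_on_SucI:
  assumes "open S" "\<And>x. x \<in> S \<Longrightarrow> (f has_derivative f' x) (at x)"
    and "\<And>v. Ck_on k S (\<lambda>x. f' x v)"
  shows "Ck_on (Suc k) S f"
proof -
  have "Ck_on k S (\<lambda>x. frechet_derivative f (at x) v)" for v
    by (rule Ck_on_cong[OF assms(1) _ assms(3)[of v]]) (simp add: frechet_derivative_at[OF assms(2), symmetric])
  then show ?thesis
    using assms(2) by (auto simp: differentiable_def)
qed

lemma Ck_on_Suc_has_derivative:
  "Ck_on (Suc k) S f \<Longrightarrow> x \<in> S \<Longrightarrow> (f has_derivative frechet_derivative f (at x)) (at x)"
  by (simp add: frechet_derivative_works)

lemma Ck_on_Suc_derivative: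
  "Ck_on (Suc k) S f \<Longrightarrow> Ck_on k S (\<lambda>x. frechet_derivative f (at x) v)"
  by (simp only: Ck_on.simps(2))

lemma Ck_on_SucD: "Ck_on (Suc k) S f \<Longrightarrow> Ck_on k S f"
proof (induction k arbitrary: f)
  case 0
  then show ?case
    by (auto intro!: continuous_at_imp_continuous_on differentiable_imp_continuous_within)
next
  case (Suc k)
  have "Ck_on (Suc k) S (\<lambda>x. frechet_derivative f (at x) v)" for v
    using Suc.prems by (simp only: Ck_on.simps(2)[of "Suc k"])
  then have "Ck_on k S (\<lambda>x. frechet_derivative f (at x) v)" for v
    by (rule Suc.IH)
  then show ?case
    using Suc.prems by (simp only: Ck_on.simps(2)) simp
qed

lemma Ck_on_le: "Ck_on m S f \<Longrightarrow> k \<le> m \<Longrightarrow> Ck_on k S f"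
proof (induction m)
  case (Suc m)
  show ?case
    by (cases "k = Suc m") (use Suc Ck_on_SucD[OF Suc.prems(1)] in simp_all)
qed simp

text \<open>Smoothness is local. The reduced energy needs this because its coordinate domain is
  covered by the domains that belong to different charts of the hidden manifold.\<close>

lemma Ck_on_locally:
  assumes "\<And>x. x \<in> S \<Longrightarrow> \<exists>T. open T \<and> x \<in> T \<and> Ck_on k T f"
  shows "Ck_on k S f"
  using assms
proof (induction k arbitrary: f)
  case 0
  then have "isCont f x" if "x \<in> S" for x
    using 0[OF that] continuous_on_eq_continuous_at unfolding Ck_on.simps(1) by blast
  then show ?case by (simp add: continuous_at_imp_continuous_on)
next
  case (Suc k)
  have "Ck_on k S (\<lambda>x. frechet_derivative f (at x) v)" for v
    by (rule Suc.IH) (use Suc.prems in \<open>blast intro: Ck_on_Suc_derivative\<close>)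
  moreover have "f differentiable at x" if "x \<in> S" for x
    using Suc.prems[OF that] Ck_on_Suc_has_derivative unfolding differentiable_def by blast
  ultimately show ?case by simp
qed

lemma Ck_on_const: "Ck_on k S (\<lambda>x. c)"
  by (induction k arbitrary: c) auto

lemma Ck_on_bounded_linear:
  assumes "open S" "bounded_linear L" "Ck_on k S f"
  shows "Ck_on k S (\<lambda>x. L (f x))"
  using assms(3)
proof (induction k arbitrary: f)
  case 0
  then show ?case
    by (simp add: bounded_linear.continuous_on[OF assms(2)])
next
  case (Suc k)
  show ?case
  proof (rule Ck_on_SucI[OF assms(1)])
    show "((\<lambda>x. L (f x)) has_derivative (\<lambda>h. L (frechet_derivative f (at x) h))) (at x)" if "x \<in> S" for x
      by (rule bounded_linear.has_derivative[OF assms(2) Ck_on_Suc_has_derivative[OF Suc.prems that]])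
    show "Ck_on k S (\<lambda>x. L (frechet_derivative f (at x) v))" for v
      by (rule Suc.IH) (use Suc.prems in simp)
  qed
qed

lemma Ck_on_ident:
  assumes "open S"
  shows "Ck_on k S (\<lambda>x. x)"
proof (cases k)
  case (Suc m)
  have "Ck_on (Suc m) S (\<lambda>x. x)"
    by (rule Ck_on_SucI[OF assms, where f' = "\<lambda>x v. v"]) (rule has_derivative_ident Ck_on_const)+
  then show ?thesis using Suc by simp
qed simp

lemma Ck_on_add:
  assumes "open S" "Ck_on k S f" "Ck_on k S g"
  shows "Ck_on k S (\<lambda>x. f x + g x)"
  using assms(2,3)
proof (induction k arbitrary: f g)
  case 0
  then show ?case by (simp add: continuous_on_add)
next
  case (Suc k)
  show ?case
  proof (rule Ck_on_SucI[OF assms(1)])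
    show "((\<lambda>x. f x + g x) has_derivative
        (\<lambda>h. frechet_derivative f (at x) h + frechet_derivative g (at x) h)) (at x)" if "x \<in> S" for x
      by (intro has_derivative_add Ck_on_Suc_has_derivative[OF Suc.prems(1) that]
          Ck_on_Suc_has_derivative[OF Suc.prems(2) that])
    show "Ck_on k S (\<lambda>x. frechet_derivative f (at x) v + frechet_derivative g (at x) v)" for v
      by (rule Suc.IH) (use Suc.prems in simp_all)
  qed
qed

lemma Ck_on_sum:
  assumes "open S" "\<And>i. i \<in> I \<Longrightarrow> Ck_on k S (f i)"
  shows "Ck_on k S (\<lambda>x. \<Sum>i\<in>I. f i x)"
  using assms(2)
  by (induction I rule: infinite_finite_induct) (auto intro: Ck_on_const Ck_on_add[OF assms(1)])

lemma Ck_on_bounded_bilinear: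
  assumes "open S" "bounded_bilinear b" "Ck_on k S f" "Ck_on k S g"
  shows "Ck_on k S (\<lambda>x. b (f x) (g x))"
  using assms(3,4)
proof (induction k arbitrary: f g)
  case 0
  then show ?case by (simp add: bounded_bilinear.continuous_on[OF assms(2)])
next
  case (Suc k)
  note f = Ck_on_SucD[OF Suc.prems(1)] and g = Ck_on_SucD[OF Suc.prems(2)]
  show ?case
  proof (rule Ck_on_SucI[OF assms(1)])
    show "((\<lambda>x. b (f x) (g x)) has_derivative
        (\<lambda>h. b (f x) (frechet_derivative g (at x) h) + b (frechet_derivative f (at x) h) (g x))) (at x)"
      if "x \<in> S" for x
      using Suc.prems that
      by (intro bounded_bilinear.FDERIV[OF assms(2)]) (auto simp: frechet_derivative_works)
    show "Ck_on k S (\<lambda>x. b (f x) (frechet_derivative g (at x) v) + b (frechet_derivative f (at x) v) (g x))" for v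
      using Suc.prems f g by (intro Ck_on_add[OF assms(1)] Suc.IH) auto
  qed
qed

lemmas Ck_on_scaleR = Ck_on_bounded_bilinear[OF _ bounded_bilinear_scaleR]
lemmas Ck_on_mult = Ck_on_bounded_bilinear[OF _ bounded_bilinear_mult]

lemma Ck_on_prod:
  fixes f :: "'i \<Rightarrow> 'a::euclidean_space \<Rightarrow> real"
  assumes "open S" "\<And>i. i \<in> I \<Longrightarrow> Ck_on k S (f i)"
  shows "Ck_on k S (\<lambda>x. \<Prod>i\<in>I. f i x)"
  using assms(2)
  by (induction I rule: infinite_finite_induct) (auto intro: Ck_on_const Ck_on_mult[OF assms(1)])

lemma Ck_on_inverse:
  fixes f :: "'a::euclidean_space \<Rightarrow> real"
  assumes "open S" "Ck_on k S f" "\<And>x. x \<in> S \<Longrightarrow> f x \<noteq> 0"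
  shows "Ck_on k S (\<lambda>x. inverse (f x))"
  using assms(2)
proof (induction k)
  case 0
  then show ?case using assms(3) by (simp add: continuous_on_inverse)
next
  case (Suc k)
  note inv = Suc.IH[OF Ck_on_SucD[OF Suc.prems]]
  show ?case
  proof (rule Ck_on_SucI[OF assms(1)])
    show "((\<lambda>x. inverse (f x)) has_derivative
        (\<lambda>h. (- 1) * (inverse (f x) * frechet_derivative f (at x) h * inverse (f x)))) (at x)"
      if "x \<in> S" for x
      using Deriv.has_derivative_inverse[where f = f, OF assms(3)[OF that]] Suc.prems that
      by (auto simp: frechet_derivative_works)
    show "Ck_on k S (\<lambda>x. (- 1) * (inverse (f x) * frechet_derivative f (at x) v * inverse (f x)))" for v
      using Suc.prems inv by (intro Ck_on_mult[OF assms(1)] Ck_on_const) auto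
  qed
qed

lemma Ck_on_Pair:
  assumes "open S" "Ck_on k S f" "Ck_on k S g"
  shows "Ck_on k S (\<lambda>x. (f x, g x))"
proof -
  have "bounded_linear (\<lambda>u. (u, 0))" "bounded_linear (\<lambda>u. (0, u))"
    by (intro bounded_linear_Pair bounded_linear_ident bounded_linear_zero)+
  from Ck_on_add[OF assms(1) Ck_on_bounded_linear[OF assms(1) this(1) assms(2)]
      Ck_on_bounded_linear[OF assms(1) this(2) assms(3)]]
  show ?thesis by simp
qed

lemma Ck_on_vec:
  fixes f :: "'a::euclidean_space \<Rightarrow> real^'n"
  assumes "open S" "\<And>i. Ck_on k S (\<lambda>x. f x $ i)"
  shows "Ck_on k S f"
proof -
  have "Ck_on k S (\<lambda>x. \<Sum>i\<in>UNIV. f x $ i *\<^sub>R axis i 1)"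
    using assms by (intro Ck_on_sum Ck_on_scaleR Ck_on_const) auto
  then show ?thesis
    by (rule Ck_on_cong[OF assms(1), rotated])
      (simp add: vec_eq_iff axis_def if_distrib cong: if_cong)
qed

text \<open>By the chain rule the derivative of the composition is \<open>D g (f x) (D f x v)\<close>. Here the direction
  \<open>D f x v\<close> moves with \<open>x\<close>, whereas \<open>Ck_on\<close> controls derivatives in fixed directions only; expanding the
  direction in the standard basis separates the two dependences.\<close>

lemma Ck_on_compose:
  assumes "open S" "open T" "Ck_on k S f" "Ck_on k T g" "f ` S \<subseteq> T"
  shows "Ck_on k S (\<lambda>x. g (f x))"
  using assms(3-5)
proof (induction k arbitrary: g)
  case 0
  then show ?case using continuous_on_compose2[of T g S f] by simp
next
  case (Suc k)
  let ?f' = "\<lambda>x. frechet_derivative f (at x)" and ?g' = "\<lambda>y. frechet_derivative g (at y)"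
  have f: "(f has_derivative ?f' x) (at x)" if "x \<in> S" for x
    using Suc.prems(1) that by (simp add: frechet_derivative_works)
  have g: "(g has_derivative ?g' (f x)) (at (f x))" if "x \<in> S" for x
    using Suc.prems(2,3) that by (auto simp: frechet_derivative_works)
  show ?case
  proof (rule Ck_on_SucI[OF assms(1)])
    have "?g' (f x) w = (\<Sum>b\<in>Basis. (w \<bullet> b) *\<^sub>R ?g' (f x) b)" if "x \<in> S" for x w
    proof -
      have "linear (?g' (f x))" using g[OF that] by (rule has_derivative_linear)
      then have "?g' (f x) (\<Sum>b\<in>Basis. (w \<bullet> b) *\<^sub>R b) = (\<Sum>b\<in>Basis. (w \<bullet> b) *\<^sub>R ?g' (f x) b)"
        by (simp only: linear_sum linear_scale)
      then show ?thesis
        by (simp only: euclidean_representation)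
    qed
    note expand = this
    show "((\<lambda>x. g (f x)) has_derivative (\<lambda>h. \<Sum>b\<in>Basis. (?f' x h \<bullet> b) *\<^sub>R ?g' (f x) b)) (at x)"
      if "x \<in> S" for x
      by (rule has_derivative_eq_rhs[OF has_derivative_compose[OF f[OF that] g[OF that]]])
        (rule ext, rule expand[OF that])
    show "Ck_on k S (\<lambda>x. \<Sum>b\<in>Basis. (?f' x v \<bullet> b) *\<^sub>R ?g' (f x) b)" for v
    proof (intro Ck_on_sum[OF assms(1)] Ck_on_scaleR[OF assms(1)])
      fix b
      show "Ck_on k S (\<lambda>x. ?f' x v \<bullet> b)"
        using Suc.prems(1)
        by (intro Ck_on_bounded_linear[OF assms(1) bounded_linear_inner_left]) auto
      show "Ck_on k S (\<lambda>x. ?g' (f x) b)"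
        using Suc.prems Ck_on_SucD[OF Suc.prems(1)] by (intro Suc.IH) auto
    qed
  qed
qed

lemma Ck_on_det:
  fixes M :: "'a::euclidean_space \<Rightarrow> real^'n^'n"
  assumes "open S" "\<And>i j. Ck_on k S (\<lambda>x. M x $ i $ j)"
  shows "Ck_on k S (\<lambda>x. det (M x))"
  unfolding det_def
  by (rule Ck_on_sum[OF assms(1) Ck_on_mult[OF assms(1) Ck_on_const Ck_on_prod[OF assms]]])

text \<open>By Cramer's rule the solution of a linear system is a rational function of its coefficients,
  whose denominator is the nonvanishing determinant.\<close>

lemma Ck_on_linear_solution:
  fixes M :: "'a::euclidean_space \<Rightarrow> real^'n^'n" and u :: "'a \<Rightarrow> real^'n"
  assumes "open S" "\<And>i j. Ck_on k S (\<lambda>x. M x $ i $ j)" "\<And>i. Ck_on k S (\<lambda>x. b x $ i)"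
    and "\<And>x. x \<in> S \<Longrightarrow> invertible (M x)" "\<And>x. x \<in> S \<Longrightarrow> M x *v u x = b x"
  shows "Ck_on k S u"
proof (rule Ck_on_vec[OF assms(1)])
  fix l
  let ?N = "\<lambda>x. \<chi> i j. if j = l then b x $ i else M x $ i $ j"
  have nz: "det (M x) \<noteq> 0" if "x \<in> S" for x
    using assms(4)[OF that] by (simp add: invertible_det_nz)
  have N: "Ck_on k S (\<lambda>x. ?N x $ i $ j)" for i j
    by (cases "j = l") (simp_all add: assms(2,3))
  have "Ck_on k S (\<lambda>x. det (?N x) * inverse (det (M x)))"
    by (rule Ck_on_mult[OF assms(1) Ck_on_det[OF assms(1) N]
          Ck_on_inverse[OF assms(1) Ck_on_det[OF assms(1,2)] nz]])
  moreover have "det (?N x) * inverse (det (M x)) = u x $ l" if "x \<in> S" for x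
    using cramer[OF nz[OF that], of "u x" "b x"] assms(5)[OF that] by (simp add: divide_inverse)
  ultimately show "Ck_on k S (\<lambda>x. u x $ l)"
    by (rule Ck_on_cong[OF assms(1), rotated])
qed

section \<open>Symmetry of second derivatives\<close>

lemma has_real_derivative_along_line:
  fixes f :: "'a::real_normed_vector \<Rightarrow> real"
  assumes "(f has_derivative f') (at (p + s *\<^sub>R u))"
  shows "((\<lambda>s. f (p + s *\<^sub>R u)) has_real_derivative f' u) (at s)"
proof -
  have "((\<lambda>s. p + s *\<^sub>R u) has_derivative (\<lambda>h. h *\<^sub>R u)) (at s)"
    by (auto intro!: derivative_eq_intros)
  from has_derivative_compose[OF this assms]
  have "((\<lambda>s. f (p + s *\<^sub>R u)) has_derivative (\<lambda>h. f' (h *\<^sub>R u))) (at s)" .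
  moreover have "f' (h *\<^sub>R u) = f' u * h" for h
    using linear_scale[OF has_derivative_linear[OF assms], of h u] by simp
  ultimately show ?thesis
    by (simp add: has_field_derivative_def)
qed

text \<open>The mean value theorem is used twice, first along \<open>u\<close> for the difference
  \<open>f (\<cdot> + h v) - f\<close> and then along \<open>v\<close> for the derivative along \<open>u\<close>. The left-hand side does not change
  when \<open>u\<close> and \<open>v\<close> are exchanged, and this is the source of the symmetry of second derivatives.\<close>

lemma second_difference_mean_value:
  fixes f :: "'a::euclidean_space \<Rightarrow> real"
  assumes f: "Ck_on 2 S f" and "h > 0"
    and S: "\<And>s t. 0 \<le> s \<Longrightarrow> s \<le> h \<Longrightarrow> 0 \<le> t \<Longrightarrow> t \<le> h \<Longrightarrow> x + s *\<^sub>R u + t *\<^sub>R v \<in> S"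
  obtains s t where "0 < s" "s < h" "0 < t" "t < h"
    "f (x + h *\<^sub>R u + h *\<^sub>R v) - f (x + h *\<^sub>R u) - f (x + h *\<^sub>R v) + f x =
      h * h * frechet_derivative (\<lambda>p. frechet_derivative f (at p) u) (at (x + s *\<^sub>R u + t *\<^sub>R v)) v"
proof -
  let ?Du = "\<lambda>p. frechet_derivative f (at p) u"
  have f1: "(f has_derivative frechet_derivative f (at p)) (at p)" if "p \<in> S" for p
    using f that by (simp add: numeral_2_eq_2 frechet_derivative_works)
  have f2: "(?Du has_derivative frechet_derivative ?Du (at p)) (at p)" if "p \<in> S" for p
    using f that by (simp add: numeral_2_eq_2 frechet_derivative_works)
  let ?\<psi> = "\<lambda>s. f ((x + h *\<^sub>R v) + s *\<^sub>R u) - f (x + s *\<^sub>R u)"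
  have "(?\<psi> has_real_derivative ?Du ((x + h *\<^sub>R v) + s *\<^sub>R u) - ?Du (x + s *\<^sub>R u)) (at s)"
    if "0 \<le> s" "s \<le> h" for s
    using S[OF that, of h] S[OF that, of 0] \<open>h > 0\<close>
    by (intro DERIV_diff has_real_derivative_along_line f1) (simp_all add: algebra_simps)
  from MVT2[OF \<open>h > 0\<close> this] obtain s where s: "0 < s" "s < h"
    "?\<psi> h - ?\<psi> 0 = h * (?Du ((x + h *\<^sub>R v) + s *\<^sub>R u) - ?Du (x + s *\<^sub>R u))"
    by auto
  have "((\<lambda>t. ?Du ((x + s *\<^sub>R u) + t *\<^sub>R v)) has_real_derivative
      frechet_derivative ?Du (at ((x + s *\<^sub>R u) + t *\<^sub>R v)) v) (at t)"
    if "0 \<le> t" "t \<le> h" for t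
    using S[of s t] that s by (intro has_real_derivative_along_line f2) simp
  from MVT2[OF \<open>h > 0\<close> this] obtain t where t: "0 < t" "t < h"
    "?Du ((x + s *\<^sub>R u) + h *\<^sub>R v) - ?Du (x + s *\<^sub>R u) =
      h * frechet_derivative ?Du (at ((x + s *\<^sub>R u) + t *\<^sub>R v)) v"
    by auto
  show thesis
    by (rule that[OF s(1,2) t(1,2)]) (use s(3) t(3) in \<open>simp add: algebra_simps\<close>)
qed

text \<open>For small \<open>h\<close> the second difference divided by \<open>h * h\<close> is a value, near \<open>x\<close>, of each of the two
  mixed derivatives. Both are continuous at \<open>x\<close>, so they cannot differ there.\<close>

lemma second_derivative_symmetric:
  fixes f :: "'a::euclidean_space \<Rightarrow> real"
  assumes "open S" "Ck_on 2 S f" "x \<in> S"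
  shows "frechet_derivative (\<lambda>p. frechet_derivative f (at p) u) (at x) v =
    frechet_derivative (\<lambda>p. frechet_derivative f (at p) v) (at x) u"
proof (rule ccontr)
  let ?D = "\<lambda>u v p. frechet_derivative (\<lambda>p. frechet_derivative f (at p) u) (at p) v"
  assume "?D u v x \<noteq> ?D v u x"
  define e where "e = \<bar>?D u v x - ?D v u x\<bar> / 2"
  then have "e > 0" using \<open>?D u v x \<noteq> ?D v u x\<close> by simp
  have "continuous_on S (?D u v)" for u v
    using assms(2) by (simp add: numeral_2_eq_2)
  then have cont: "isCont (?D u v) x" for u v
    using assms(1,3) continuous_on_eq_continuous_at by blast
  obtain d1 where d1: "d1 > 0" "\<And>p. dist p x < d1 \<Longrightarrow> \<bar>?D u v p - ?D u v x\<bar> < e"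
    using cont[of u v] \<open>e > 0\<close> unfolding continuous_at_eps_delta dist_real_def by meson
  obtain d2 where d2: "d2 > 0" "\<And>p. dist p x < d2 \<Longrightarrow> \<bar>?D v u p - ?D v u x\<bar> < e"
    using cont[of v u] \<open>e > 0\<close> unfolding continuous_at_eps_delta dist_real_def by meson
  obtain d3 where d3: "d3 > 0" "ball x d3 \<subseteq> S"
    using assms(1,3) open_contains_ball by blast
  define d where "d = min d1 (min d2 d3)"
  \<comment> \<open>The added 1 keeps the quotient defined when both directions vanish.\<close>
  define h where "h = d / (norm u + norm v + 1)"
  have "d > 0" using d1 d2 d3 by (simp add: d_def)
  have nz: "norm u + norm v + 1 > 0" by (smt (verit) norm_ge_zero)
  then have "h > 0" using \<open>d > 0\<close> by (simp add: h_def)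
  have hd: "h * norm u + h * norm v < d"
  proof -
    have "h * (norm u + norm v + 1) = d" using nz by (simp add: h_def)
    then show ?thesis using \<open>h > 0\<close> by (simp add: algebra_simps)
  qed
  have near: "dist (x + s *\<^sub>R u + t *\<^sub>R v) x < d" if "0 \<le> s" "s \<le> h" "0 \<le> t" "t \<le> h" for s t
  proof -
    have "norm (s *\<^sub>R u + t *\<^sub>R v) \<le> s * norm u + t * norm v"
      using norm_triangle_ineq[of "s *\<^sub>R u" "t *\<^sub>R v"] that by simp
    also have "\<dots> \<le> h * norm u + h * norm v"
      using that by (intro add_mono mult_right_mono) auto
    finally show ?thesis using hd by (simp add: dist_norm add.assoc)
  qed
  have near': "x + s *\<^sub>R u + t *\<^sub>R v \<in> S" if "0 \<le> s" "s \<le> h" "0 \<le> t" "t \<le> h" for s t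
    using near[OF that] d3 by (auto simp: d_def dist_commute)
  obtain s t where st: "0 < s" "s < h" "0 < t" "t < h"
    "f (x + h *\<^sub>R u + h *\<^sub>R v) - f (x + h *\<^sub>R u) - f (x + h *\<^sub>R v) + f x =
      h * h * ?D u v (x + s *\<^sub>R u + t *\<^sub>R v)"
    by (rule second_difference_mean_value[OF assms(2) \<open>h > 0\<close> near'])
  have near'': "x + t *\<^sub>R v + s *\<^sub>R u \<in> S" if "0 \<le> t" "t \<le> h" "0 \<le> s" "s \<le> h" for s t
    using near'[of s t] that by (simp add: algebra_simps)
  obtain t' s' where st': "0 < t'" "t' < h" "0 < s'" "s' < h"
    "f (x + h *\<^sub>R v + h *\<^sub>R u) - f (x + h *\<^sub>R v) - f (x + h *\<^sub>R u) + f x =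
      h * h * ?D v u (x + t' *\<^sub>R v + s' *\<^sub>R u)"
    by (rule second_difference_mean_value[OF assms(2) \<open>h > 0\<close> near''])
  have "h * h * ?D u v (x + s *\<^sub>R u + t *\<^sub>R v) = h * h * ?D v u (x + s' *\<^sub>R u + t' *\<^sub>R v)"
    using st(5) st'(5) by (simp add: algebra_simps)
  then have "?D u v (x + s *\<^sub>R u + t *\<^sub>R v) = ?D v u (x + s' *\<^sub>R u + t' *\<^sub>R v)"
    using \<open>h > 0\<close> by simp
  moreover have "\<bar>?D u v (x + s *\<^sub>R u + t *\<^sub>R v) - ?D u v x\<bar> < e"
    using near[of s t] st by (intro d1) (simp add: d_def)
  moreover have "\<bar>?D v u (x + s' *\<^sub>R u + t' *\<^sub>R v) - ?D v u x\<bar> < e"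
    using near[of s' t'] st' by (intro d2) (simp add: d_def)
  ultimately show False unfolding e_def by argo
qed

section \<open>Derivative of an implicitly defined function\<close>

text \<open>Because \<open>g\<close> is given and continuous, one expansion of \<open>G\<close> at \<open>(x, g x)\<close> suffices. Applying
  the left inverse \<open>T\<close> of the partial derivative of \<open>G\<close> to it bounds the error \<open>g y - g x + L (y - x)\<close>
  by a small multiple of \<open>norm (y - x) + norm (g y - g x)\<close>. A first use of this bound shows that
  \<open>g\<close> is Lipschitz at \<open>x\<close>; then the error is \<open>o(norm (y - x))\<close>.\<close>

lemma has_derivative_implicit:
  fixes G :: "'a::real_normed_vector \<times> 'b::real_normed_vector \<Rightarrow> 'c::real_normed_vector"
  assumes G: "(G has_derivative G') (at (x, g x))"
    and U: "open U" "x \<in> U" "\<And>y. y \<in> U \<Longrightarrow> G (y, g y) = 0"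
    and g: "isCont g x"
    and T: "bounded_linear T" "\<And>k. T (G' (0, k)) = k"
  shows "(g has_derivative (\<lambda>h. - T (G' (h, 0)))) (at x)"
proof -
  define L where "L = (\<lambda>h. T (G' (h, 0)))"
  have G'_linear: "bounded_linear G'"
    using G by (rule has_derivative_bounded_linear)
  have L: "bounded_linear L"
    unfolding L_def
    by (intro bounded_linear_compose[OF T(1)] bounded_linear_compose[OF G'_linear]
        bounded_linear_Pair bounded_linear_ident bounded_linear_zero)
  obtain B where B: "B > 0" "\<And>w. norm (T w) \<le> norm w * B"
    using bounded_linear.pos_bounded[OF T(1)] by blast
  obtain M where M: "M > 0" "\<And>w. norm (L w) \<le> norm w * M"
    using bounded_linear.pos_bounded[OF L] by blast
  have estimate: "\<exists>d>0. \<forall>y. norm (y - x) < d \<longrightarrow>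
      norm (g y - g x + L (y - x)) \<le> e * (norm (y - x) + norm (g y - g x))" if "e > 0" for e
  proof -
    have "e / B > 0" using \<open>e > 0\<close> B by simp
    then obtain d0 where d0: "d0 > 0" "\<And>p. norm (p - (x, g x)) < d0 \<Longrightarrow>
        norm (G p - G (x, g x) - G' (p - (x, g x))) \<le> e / B * norm (p - (x, g x))"
      using G unfolding has_derivative_at_alt by blast
    obtain d1 where d1: "d1 > 0" "\<And>y. dist y x < d1 \<Longrightarrow> dist (g y) (g x) < d0 / 2"
      using g \<open>d0 > 0\<close> unfolding continuous_at_eps_delta by (meson half_gt_zero)
    obtain d2 where d2: "d2 > 0" "ball x d2 \<subseteq> U"
      using U open_contains_ball by blast
    define d where "d = min (d0 / 2) (min d1 d2)"
    have "d > 0" using d0 d1 d2 by (simp add: d_def)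
    moreover have "norm (g y - g x + L (y - x)) \<le> e * (norm (y - x) + norm (g y - g x))"
      if "norm (y - x) < d" for y
    proof -
      have "y \<in> U" using that d2 by (auto simp: d_def dist_norm norm_minus_commute)
      have pn: "norm ((y, g y) - (x, g x)) \<le> norm (y - x) + norm (g y - g x)"
        using norm_Pair_le[of "y - x" "g y - g x"] by simp
      moreover have "norm (g y - g x) < d0 / 2"
        using d1(2)[of y] that by (simp add: d_def dist_norm)
      ultimately have "norm ((y, g y) - (x, g x)) < d0"
        using that by (simp add: d_def)
      from d0(2)[OF this] have "norm (G' (y - x, g y - g x)) \<le> e / B * norm ((y, g y) - (x, g x))"
        using U \<open>y \<in> U\<close> by simp
      also have "\<dots> \<le> e / B * (norm (y - x) + norm (g y - g x))"
        using pn \<open>e / B > 0\<close> by (intro mult_left_mono) auto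
      finally have bound: "norm (G' (y - x, g y - g x)) * B \<le> e * (norm (y - x) + norm (g y - g x))"
        using B(1) by (simp add: field_simps)
      have "G' (y - x, g y - g x) = G' (y - x, 0) + G' (0, g y - g x)"
        using linear_add[OF bounded_linear.linear[OF G'_linear], of "(y - x, 0)" "(0, g y - g x)"] by simp
      then have "T (G' (y - x, g y - g x)) = L (y - x) + (g y - g x)"
        using linear_add[OF bounded_linear.linear[OF T(1)]] T(2) by (simp add: L_def)
      then have "norm (g y - g x + L (y - x)) \<le> norm (G' (y - x, g y - g x)) * B"
        using B(2)[of "G' (y - x, g y - g x)"] by (simp add: add.commute)
      then show ?thesis using bound by simp
    qed
    ultimately show ?thesis by blast
  qed
  \<comment> \<open>The factor 1/2 lets the term \<open>norm (g y - g x)\<close> on the right be absorbed on the left.\<close>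
  obtain d0 where d0: "d0 > 0" "\<And>y. norm (y - x) < d0 \<Longrightarrow>
      norm (g y - g x + L (y - x)) \<le> 1 / 2 * (norm (y - x) + norm (g y - g x))"
    using estimate[of "1 / 2"] by auto
  have lipschitz: "norm (g y - g x) \<le> (2 * M + 1) * norm (y - x)" if "norm (y - x) < d0" for y
  proof -
    have "norm (g y - g x) \<le> norm (g y - g x + L (y - x)) + norm (L (y - x))"
      using norm_triangle_ineq4[of "g y - g x + L (y - x)" "L (y - x)"] by simp
    then have "norm (g y - g x) \<le> 1 / 2 * (norm (y - x) + norm (g y - g x)) + norm (y - x) * M"
      using d0(2)[OF that] M(2)[of "y - x"] by linarith
    then show ?thesis by (simp add: algebra_simps)
  qed
  have "(g has_derivative (\<lambda>h. - L h)) (at x)"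
    unfolding has_derivative_at_alt
  proof (intro conjI allI impI)
    show "bounded_linear (\<lambda>h. - L h)" by (rule bounded_linear_minus[OF L])
    fix e :: real assume "e > 0"
    then have "e / (2 * M + 2) > 0" using M(1) by simp
    from estimate[OF this] obtain d where d: "d > 0" "\<And>y. norm (y - x) < d \<Longrightarrow>
      norm (g y - g x + L (y - x)) \<le> e / (2 * M + 2) * (norm (y - x) + norm (g y - g x))"
      by blast
    have "norm (g y - g x - - L (y - x)) \<le> e * norm (y - x)" if "norm (y - x) < min d d0" for y
    proof -
      have "norm (y - x) + norm (g y - g x) \<le> (2 * M + 2) * norm (y - x)"
        using lipschitz[of y] that by (simp add: algebra_simps)
      then have "e / (2 * M + 2) * (norm (y - x) + norm (g y - g x)) \<le>
          e / (2 * M + 2) * ((2 * M + 2) * norm (y - x))"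
        using \<open>e / (2 * M + 2) > 0\<close> by (intro mult_left_mono) auto
      also have "\<dots> = e * norm (y - x)"
        using M(1) by simp
      finally show ?thesis
        using d(2)[of y] that by simp
    qed
    then show "\<exists>d>0. \<forall>y. norm (y - x) < d \<longrightarrow> norm (g y - g x - - L (y - x)) \<le> e * norm (y - x)"
      using d(1) d0(1) by (intro exI[of _ "min d d0"]) simp
  qed
  then show ?thesis by (simp add: L_def)
qed

section \<open>Matrix inverses and positive definiteness\<close>

lemma matrix_vector_mult_minus:
  fixes M :: "real^'n^'m"
  shows "(- M) *v v = - (M *v v)" "M *v (- v) = - (M *v v)"
  by (simp_all add: vec_eq_iff matrix_vector_mult_def sum_negf)

lemma matrix_inv_inverts:
  fixes M :: "real^'n^'n"
  assumes "invertible M"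
  shows "M ** matrix_inv M = mat 1" "matrix_inv M ** M = mat 1"
proof -
  have "M ** matrix_inv M = mat 1 \<and> matrix_inv M ** M = mat 1"
    using assms unfolding invertible_def matrix_inv_def by (rule someI_ex)
  then show "M ** matrix_inv M = mat 1" "matrix_inv M ** M = mat 1" by auto
qed

lemma pos_def_imp_invertible:
  fixes M :: "real^'n^'n"
  assumes "pos_def M"
  shows "invertible M"
proof -
  have "v = 0" if "M *v v = 0" for v
    using assms that unfolding pos_def_def by (metis inner_zero_right less_irrefl)
  then show ?thesis
    by (simp add: invertible_left_inverse matrix_left_invertible_ker)
qed

section \<open>Schur complements\<close>

lemma sum_UNIV_sum_type:
  "(\<Sum>k\<in>(UNIV :: ('a::finite + 'b::finite) set). f k) = (\<Sum>i\<in>UNIV. f (Inl i)) + (\<Sum>j\<in>UNIV. f (Inr j))"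
  using sum.Plus[of "UNIV :: 'a set" "UNIV :: 'b set" f] by (simp add: comp_def)

lemma matrix_mult_diff:
  fixes M :: "real^'n^'m"
  shows "M ** (N - N') = M ** N - M ** N'" "(M - M') ** N = M ** N - M' ** N"
  by (simp_all add: vec_eq_iff matrix_matrix_mult_def algebra_simps sum_subtractf)

lemma block_mult_case_sum:
  fixes X :: "real^'k^('i::finite + 'j::finite)"
  shows "block p (case_sum a b) M ** X =
    block p a M ** (\<chi> i. X $ Inl i) + block p b M ** (\<chi> j. X $ Inr j)"
  by (simp add: vec_eq_iff matrix_matrix_mult_def block_def sum_UNIV_sum_type)

lemma block_mult_rows:
  "(\<chi> i. (block (case_sum a b) q M ** X) $ Inl i) = block a q M ** X"
  "(\<chi> j. (block (case_sum a b) q M ** X) $ Inr j) = block b q M ** X"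
  by (simp_all add: vec_eq_iff matrix_matrix_mult_def block_def)

lemma block_rows:
  "(\<chi> i. block (case_sum a b) q M $ Inl i) = block a q M"
  "(\<chi> j. block (case_sum a b) q M $ Inr j) = block b q M"
  by (simp_all add: vec_eq_iff block_def)

lemma block_schur:
  "block u v (schur c h M) = block (c \<circ> u) (c \<circ> v) M -
    block (c \<circ> u) h M ** matrix_inv (block h h M) ** block h (c \<circ> v) M"
  by (simp add: vec_eq_iff schur_def block_def matrix_matrix_mult_def)

text \<open>A Schur complement can be computed from any solution of the linear system of the eliminated
  variables, without mentioning the inverse matrix.\<close>

lemma schur_eq_solution:
  assumes "invertible (block h h M)" "block h h M ** X = block h w M"
  shows "schur w h M = block w w M - block w h M ** X"
proof -
  have "matrix_inv (block h h M) ** block h w M = X"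
    by (simp add: assms(2)[symmetric] matrix_mul_assoc matrix_inv_inverts(2)[OF assms(1)])
  then show ?thesis
    by (simp add: schur_def matrix_mul_assoc[symmetric])
qed

text \<open>Vectors that vanish on the first group of variables are enough to test the second diagonal block.\<close>

lemma pos_def_block_Inr:
  fixes M :: "real^'n^'n" and a :: "'i::finite \<Rightarrow> 'n" and b :: "'j::finite \<Rightarrow> 'n"
  assumes "pos_def (block (case_sum a b) (case_sum a b) M)"
  shows "pos_def (block b b M)"
  unfolding pos_def_def
proof (intro allI impI)
  fix v :: "real^'j" assume "v \<noteq> 0"
  let ?u = "(\<chi> k. case k of Inl i \<Rightarrow> 0 | Inr j \<Rightarrow> v $ j) :: real^('i + 'j)"
  have "?u \<noteq> 0"
  proof
    assume "?u = 0"
    then have "?u $ Inr j = 0" for j by simp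
    then show False using \<open>v \<noteq> 0\<close> by (simp add: vec_eq_iff)
  qed
  then have "?u \<bullet> (block (case_sum a b) (case_sum a b) M *v ?u) > 0"
    using assms by (simp add: pos_def_def)
  then show "v \<bullet> (block b b M *v v) > 0"
    by (simp add: inner_vec_def matrix_vector_mult_def block_def sum_UNIV_sum_type)
qed

text \<open>Block Gaussian elimination: the second equation is solved for \<open>Y\<close>, and the result is substituted
  into the first. The matrix that remains in front of \<open>X\<close> is the Schur complement of \<open>D\<close>.\<close>

lemma block_elimination:
  fixes D :: "real^'n^'n"
  assumes "invertible D" "A ** X + B ** Y = P" "C ** X + D ** Y = Q"
  shows "Y = matrix_inv D ** (Q - C ** X)"
    and "(A - B ** matrix_inv D ** C) ** X = P - B ** matrix_inv D ** Q"
proof -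
  have "Q - C ** X = D ** Y" using assms(3) by (simp add: algebra_simps)
  then show Y: "Y = matrix_inv D ** (Q - C ** X)"
    by (simp add: matrix_mul_assoc matrix_inv_inverts(2)[OF assms(1)])
  have "A ** X = P - B ** Y" using assms(2) by (simp add: algebra_simps)
  then show "(A - B ** matrix_inv D ** C) ** X = P - B ** matrix_inv D ** Q"
    by (subst (asm) Y) (simp add: matrix_mult_diff matrix_mul_assoc)
qed

text \<open>Let \<open>X\<close> solve the joint system of the eliminated variables, with parts \<open>Xa\<close> and \<open>Xb\<close>. Eliminating \<open>Xb\<close>
  shows that \<open>Xa\<close> solves the system belonging to the matrix that is left after the first elimination.
  So the same \<open>X\<close> computes both sides.\<close>

theorem schur_sequential:
  fixes M :: "real^'n^'n" and w :: "'w::finite \<Rightarrow> 'n" and a :: "'i::finite \<Rightarrow> 'n" and b :: "'j::finite \<Rightarrow> 'n"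
  assumes "pos_def (block (case_sum a b) (case_sum a b) M)"
  shows "schur w (case_sum a b) M = schur Inl Inr (schur (case_sum w a) b M)"
proof -
  let ?ab = "case_sum a b"
  let ?K = "block ?ab ?ab M"
  let ?S = "schur (case_sum w a) b M"
  let ?D = "matrix_inv (block b b M)"
  have K: "invertible ?K" and D: "invertible (block b b M)"
    using assms by (auto intro: pos_def_imp_invertible pos_def_block_Inr)
  have rows: "block a a M ** (\<chi> i. X $ Inl i) + block a b M ** (\<chi> j. X $ Inr j) = (\<chi> i. C $ Inl i)"
    "block b a M ** (\<chi> i. X $ Inl i) + block b b M ** (\<chi> j. X $ Inr j) = (\<chi> j. C $ Inr j)"
    if "?K ** X = C" for X C :: "real^'k^('i + 'j)"
    using that by (auto simp: block_mult_rows simp flip: block_mult_case_sum)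
  have Saa: "block Inr Inr ?S = block a a M - block a b M ** ?D ** block b a M"
    by (simp add: block_schur comp_def)
  \<comment> \<open>The first block column of the inverse of \<open>?K\<close> provides a right inverse of the Schur complement \<open>block Inr Inr ?S\<close>.\<close>
  define C :: "real^'i^('i + 'j)" where "C = (\<chi> k. case k of Inl i \<Rightarrow> mat 1 $ i | Inr j \<Rightarrow> 0)"
  have C: "(\<chi> i. C $ Inl i) = mat 1" "(\<chi> j. C $ Inr j) = 0"
    by (simp_all add: C_def vec_eq_iff)
  have "?K ** (matrix_inv ?K ** C) = C"
    by (simp add: matrix_mul_assoc matrix_inv_inverts(1)[OF K])
  from block_elimination(2)[OF D rows[OF this]]
  have "block Inr Inr ?S ** (\<chi> i. (matrix_inv ?K ** C) $ Inl i) = mat 1"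
    by (simp add: C Saa)
  then have S: "invertible (block Inr Inr ?S)"
    using invertible_right_inverse by blast
  define X where "X = matrix_inv ?K ** block ?ab w M"
  let ?Xa = "\<chi> i. X $ Inl i" and ?Xb = "\<chi> j. X $ Inr j"
  have X: "?K ** X = block ?ab w M"
    by (simp add: X_def matrix_mul_assoc matrix_inv_inverts(1)[OF K])
  note elim = block_elimination[OF D rows[OF X], unfolded block_rows]
  have "block Inr Inr ?S ** ?Xa = block Inr Inl ?S"
    by (simp add: Saa elim(2) block_schur comp_def)
  from schur_eq_solution[OF S this]
  have "schur Inl Inr ?S = block Inl Inl ?S - block Inl Inr ?S ** ?Xa" .
  also have "\<dots> = block w w M - (block w a M ** ?Xa + block w b M ** (?D ** (block b w M - block b a M ** ?Xa)))"
    by (simp add: block_schur comp_def matrix_mult_diff matrix_mul_assoc)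
  also have "\<dots> = block w w M - block w ?ab M ** X"
    by (simp only: elim(1)[symmetric] block_mult_case_sum)
  also have "\<dots> = schur w ?ab M"
    using schur_eq_solution[OF K X] by simp
  finally show ?thesis by simp
qed

section \<open>Gradients and Hessian blocks\<close>

text \<open>Functions that agree near \<open>x\<close> satisfy \<open>has_derivative\<close> at \<open>x\<close> with the same linear maps, and
  \<open>frechet_derivative\<close> is a choice from these.\<close>

lemma frechet_derivative_cong_open:
  assumes "open U" "x \<in> U" "\<And>y. y \<in> U \<Longrightarrow> f y = g y"
  shows "frechet_derivative f (at x) = frechet_derivative g (at x)"
proof -
  have "(f has_derivative D) (at x) \<longleftrightarrow> (g has_derivative D) (at x)" for D
    using assms has_derivative_transform_within_open[of f D x UNIV U g]
      has_derivative_transform_within_open[of g D x UNIV U f] by auto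
  then show ?thesis
    by (simp add: frechet_derivative_def)
qed

lemma gradient_cong_open:
  assumes "open U" "x \<in> U" "\<And>y. y \<in> U \<Longrightarrow> f y = g y"
  shows "gradient f x = gradient g x"
  using frechet_derivative_cong_open[OF assms] by (simp add: gradient_def)

lemma hessian_cong_open:
  assumes "open U" "x \<in> U" "\<And>y. y \<in> U \<Longrightarrow> f y = g y"
  shows "hessian f x = hessian g x"
  using frechet_derivative_cong_open[OF assms(1,2) gradient_cong_open[OF assms(1) _ assms(3)]]
  by (simp add: hessian_def jacobian_def)

text \<open>The partial gradients are functions of the pair of variables, so that their derivatives contain
  all Hessian blocks at once.\<close>

definition hidden_gradient :: "((real^'z) \<times> (real^'s) \<Rightarrow> real) \<Rightarrow> (real^'z) \<times> (real^'s) \<Rightarrow> real^'s" where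
  "hidden_gradient F p = gradient (\<lambda>y. F (fst p, y)) (snd p)"

definition visible_gradient :: "((real^'z) \<times> (real^'s) \<Rightarrow> real) \<Rightarrow> (real^'z) \<times> (real^'s) \<Rightarrow> real^'z" where
  "visible_gradient F p = gradient (\<lambda>x. F (x, snd p)) (fst p)"

lemma has_derivative_partial:
  assumes "(f has_derivative f') (at (x, y))"
  shows "((\<lambda>x. f (x, y)) has_derivative (\<lambda>h. f' (h, 0))) (at x)"
    and "((\<lambda>y. f (x, y)) has_derivative (\<lambda>k. f' (0, k))) (at y)"
proof -
  have "((\<lambda>x. (x, y)) has_derivative (\<lambda>h. (h, 0))) (at x)"
    by (intro has_derivative_Pair has_derivative_ident has_derivative_const)
  from has_derivative_compose[OF this assms]
  show "((\<lambda>x. f (x, y)) has_derivative (\<lambda>h. f' (h, 0))) (at x)" .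
  have "((\<lambda>y. (x, y)) has_derivative (\<lambda>k. (0, k))) (at y)"
    by (intro has_derivative_Pair has_derivative_ident has_derivative_const)
  from has_derivative_compose[OF this assms]
  show "((\<lambda>y. f (x, y)) has_derivative (\<lambda>k. f' (0, k))) (at y)" .
qed

lemma gradient_eq:
  assumes "(f has_derivative f') (at x)"
  shows "gradient f x $ i = f' (axis i 1)"
  by (simp add: gradient_def frechet_derivative_at[OF assms, symmetric])

lemma gradient_nth_eq_derivative:
  assumes "(F has_derivative F') (at p)"
  shows "hidden_gradient F p $ j = F' (0, axis j 1)" "visible_gradient F p $ i = F' (axis i 1, 0)"
  using has_derivative_partial[of F F' "fst p" "snd p"] assms
  by (simp_all add: hidden_gradient_def visible_gradient_def gradient_eq)

lemma derivative_hidden: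
  assumes "(F has_derivative F') (at p)"
  shows "F' (0, k) = hidden_gradient F p \<bullet> k"
proof -
  have lin: "linear (\<lambda>k. F' (0, k))"
    using has_derivative_linear[OF has_derivative_partial(2)[of F F' "fst p" "snd p"]] assms by simp
  have "F' (0, \<Sum>i\<in>UNIV. k $ i *\<^sub>R axis i 1) = (\<Sum>i\<in>UNIV. k $ i *\<^sub>R F' (0, axis i 1))"
    by (simp only: linear_sum[OF lin] linear_scale[OF lin])
  moreover have "(\<Sum>i\<in>UNIV. k $ i *\<^sub>R axis i 1) = k"
    by (simp add: vec_eq_iff axis_def if_distrib cong: if_cong)
  ultimately show ?thesis
    by (simp add: gradient_nth_eq_derivative(1)[OF assms] inner_vec_def mult.commute)
qed

lemma jacobian_eq:
  fixes f :: "real^'n \<Rightarrow> real^'m"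
  assumes "(f has_derivative f') (at x)"
  shows "jacobian f (at x) *v h = f' h"
proof -
  have "(f has_derivative (\<lambda>h. jacobian f (at x) *v h)) (at x)"
    by (rule jacobian_works[THEN iffD1]) (use assms in \<open>auto simp: differentiable_def\<close>)
  then show ?thesis using has_derivative_unique[OF assms] by metis
qed

lemma jacobian_unique:
  fixes f :: "real^'n \<Rightarrow> real^'m"
  assumes "(f has_derivative (\<lambda>h. M *v h)) (at x)"
  shows "jacobian f (at x) = M"
  using jacobian_eq[OF assms] by (simp add: matrix_eq)

lemma Hessian_blocks:
  assumes "(hidden_gradient F has_derivative G') (at (x, y))"
  shows "E_ss F x y *v k = G' (0, k)" "E_sz F x y *v h = G' (h, 0)"
proof -
  have "E_ss F x y = jacobian (\<lambda>y. hidden_gradient F (x, y)) (at y)"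
    by (simp add: E_ss_def hessian_def hidden_gradient_def[abs_def])
  then show "E_ss F x y *v k = G' (0, k)"
    using jacobian_eq[OF has_derivative_partial(2)[OF assms]] by simp
  have "E_sz F x y = jacobian (\<lambda>x. hidden_gradient F (x, y)) (at x)"
    by (simp add: E_sz_def hidden_gradient_def[abs_def])
  then show "E_sz F x y *v h = G' (h, 0)"
    using jacobian_eq[OF has_derivative_partial(1)[OF assms]] by simp
qed

lemma Hessian_block_zz:
  assumes "(visible_gradient F has_derivative V') (at (x, y))"
  shows "E_zz F x y *v h = V' (h, 0)"
proof -
  have "E_zz F x y = jacobian (\<lambda>x. visible_gradient F (x, y)) (at x)"
    by (simp add: E_zz_def hessian_def visible_gradient_def[abs_def])
  then show ?thesis
    using jacobian_eq[OF has_derivative_partial(1)[OF assms]] by simp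
qed

lemma Ck_on_gradients:
  assumes "open W" "Ck_on (Suc k) W F"
  shows "Ck_on k W (hidden_gradient F)" "Ck_on k W (visible_gradient F)"
proof -
  have D: "(F has_derivative frechet_derivative F (at p)) (at p)" if "p \<in> W" for p
    using Ck_on_Suc_has_derivative[OF assms(2) that] .
  have C: "Ck_on k W (\<lambda>p. frechet_derivative F (at p) v)" for v
    by (rule Ck_on_Suc_derivative[OF assms(2)])
  show "Ck_on k W (hidden_gradient F)"
    by (rule Ck_on_vec[OF assms(1)], rule Ck_on_cong[OF assms(1) _ C])
      (simp add: gradient_nth_eq_derivative[OF D])
  show "Ck_on k W (visible_gradient F)"
    by (rule Ck_on_vec[OF assms(1)], rule Ck_on_cong[OF assms(1) _ C])
      (simp add: gradient_nth_eq_derivative[OF D])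
qed

text \<open>The block \<open>E_zs\<close> is defined as the transpose of \<open>E_sz\<close>, that is, with the visible derivative
  taken last. The symmetry of second derivatives identifies it with the hidden derivative of the
  visible gradient, which is what the chain rule produces.\<close>

lemma mixed_Hessian_block:
  assumes "open W" "Ck_on 2 W F" "(x, y) \<in> W"
    and V: "(visible_gradient F has_derivative V') (at (x, y))"
  shows "E_zs F x y *v k = V' (0, k)"
proof -
  have W1: "Ck_on (Suc 1) W F" using assms(2) by (simp add: numeral_2_eq_2)
  have D: "(F has_derivative frechet_derivative F (at p)) (at p)" if "p \<in> W" for p
    using Ck_on_Suc_has_derivative[OF W1 that] .
  have G: "(hidden_gradient F has_derivative frechet_derivative (hidden_gradient F) (at (x, y))) (at (x, y))"
    using Ck_on_gradients(1)[OF assms(1) W1] assms(3) by (simp add: frechet_derivative_works)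
  let ?G' = "frechet_derivative (hidden_gradient F) (at (x, y))"
  have nth: "frechet_derivative (\<lambda>p. frechet_derivative F (at p) w) (at (x, y)) = (\<lambda>v. q' v $ i)"
    if q: "(q has_derivative q') (at (x, y))" "\<And>p. p \<in> W \<Longrightarrow> q p $ i = frechet_derivative F (at p) w"
    for q :: "(real^'a) \<times> (real^'b) \<Rightarrow> real^'c" and q' i w
  proof -
    have "((\<lambda>p. q p $ i) has_derivative (\<lambda>v. q' v $ i)) (at (x, y))"
      by (rule bounded_linear.has_derivative[OF bounded_linear_vec_nth q(1)])
    from has_derivative_transform_within_open[OF this assms(1,3) q(2)]
    show ?thesis by (simp add: frechet_derivative_at[symmetric])
  qed
  have "V' (0, axis j 1) $ i = ?G' (axis i 1, 0) $ j" for i j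
  proof -
    have "V' (0, axis j 1) $ i =
        frechet_derivative (\<lambda>p. frechet_derivative F (at p) (axis i 1, 0)) (at (x, y)) (0, axis j 1)"
      by (subst nth[OF V gradient_nth_eq_derivative(2)[OF D]]) auto
    also have "\<dots> =
        frechet_derivative (\<lambda>p. frechet_derivative F (at p) (0, axis j 1)) (at (x, y)) (axis i 1, 0)"
      by (rule second_derivative_symmetric[OF assms(1-3)])
    also have "\<dots> = ?G' (axis i 1, 0) $ j"
      by (subst nth[OF G gradient_nth_eq_derivative(1)[OF D]]) auto
    finally show ?thesis .
  qed
  moreover have "E_sz F x y $ j $ i = ?G' (axis i 1, 0) $ j" for i j
    using Hessian_blocks(2)[OF G, of "axis i 1", symmetric]
    by (simp add: matrix_vector_mult_basis column_def)
  moreover have "jacobian (\<lambda>y. visible_gradient F (x, y)) (at y) $ i $ j = V' (0, axis j 1) $ i" for i j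
    using jacobian_eq[OF has_derivative_partial(2)[OF V], of "axis j 1", symmetric]
    by (simp add: matrix_vector_mult_basis column_def)
  ultimately have "E_zs F x y = jacobian (\<lambda>y. visible_gradient F (x, y)) (at y)"
    by (simp add: E_zs_def transpose_def vec_eq_iff)
  then show ?thesis
    using jacobian_eq[OF has_derivative_partial(2)[OF V]] by simp
qed

section \<open>Sections of nondegenerate critical points\<close>

text \<open>In coordinates the minimizer enters only as a continuous selection \<open>g\<close> of critical points in the
  hidden variables at which the hidden Hessian block is invertible.\<close>

locale critical_section =
  fixes W :: "((real^'z) \<times> (real^'s)) set" and F :: "(real^'z) \<times> (real^'s) \<Rightarrow> real"
    and U :: "(real^'z) set" and g :: "real^'z \<Rightarrow> real^'s" and r :: nat
  assumes open_W: "open W" and open_U: "open U" and r_pos: "r \<ge> 1"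
    and F_Ck: "Ck_on (Suc r) W F"
    and g_cont: "continuous_on U g" and graph: "\<And>x. x \<in> U \<Longrightarrow> (x, g x) \<in> W"
    and critical: "\<And>x. x \<in> U \<Longrightarrow> hidden_gradient F (x, g x) = 0"
    and nondegenerate: "\<And>x. x \<in> U \<Longrightarrow> invertible (E_ss F x (g x))"
begin

lemma hidden_gradient_deriv:
  assumes "p \<in> W"
  shows "(hidden_gradient F has_derivative frechet_derivative (hidden_gradient F) (at p)) (at p)"
  using Ck_on_le[OF Ck_on_gradients(1)[OF open_W F_Ck], of "Suc 0"] r_pos assms
  by (auto intro: Ck_on_Suc_has_derivative simp del: Ck_on.simps(2))

lemma visible_gradient_deriv:
  assumes "p \<in> W"
  shows "(visible_gradient F has_derivative frechet_derivative (visible_gradient F) (at p)) (at p)"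
  using Ck_on_le[OF Ck_on_gradients(2)[OF open_W F_Ck], of "Suc 0"] r_pos assms
  by (auto intro: Ck_on_Suc_has_derivative simp del: Ck_on.simps(2))

lemma section_has_derivative:
  assumes "x \<in> U"
  shows "(g has_derivative (\<lambda>h. - (matrix_inv (E_ss F x (g x)) ** E_sz F x (g x)) *v h)) (at x)"
proof -
  let ?G' = "frechet_derivative (hidden_gradient F) (at (x, g x))"
  let ?T = "(*v) (matrix_inv (E_ss F x (g x)))"
  note G' = hidden_gradient_deriv[OF graph[OF assms]]
  have "isCont g x"
    using g_cont open_U assms continuous_on_eq_continuous_at by blast
  moreover have "?T (?G' (0, k)) = k" for k
    using matrix_inv_inverts(2)[OF nondegenerate[OF assms]]
    by (simp add: Hessian_blocks(1)[OF G', symmetric] matrix_vector_mul_assoc)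
  ultimately have "(g has_derivative (\<lambda>h. - ?T (?G' (h, 0)))) (at x)"
    by (intro has_derivative_implicit[OF G' open_U assms critical]) auto
  moreover have "- ?T (?G' (h, 0)) = - (matrix_inv (E_ss F x (g x)) ** E_sz F x (g x)) *v h" for h
    by (simp add: Hessian_blocks(2)[OF G', symmetric] matrix_vector_mul_assoc
        matrix_vector_mult_minus)
  ultimately show ?thesis by simp
qed

text \<open>The derivative of \<open>g\<close> in direction \<open>h\<close> solves a linear system whose coefficients are first derivatives of
  the hidden gradient at \<open>(x, g x)\<close>, hence as smooth as \<open>g\<close> up to order \<open>r - 1\<close>.\<close>

lemma Ck_on_section_derivative:
  assumes "Ck_on k U g" "k < r"
  shows "Ck_on k U (\<lambda>x. - (matrix_inv (E_ss F x (g x)) ** E_sz F x (g x)) *v h)"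
proof -
  let ?G' = "\<lambda>x. frechet_derivative (hidden_gradient F) (at (x, g x))"
  note G' = hidden_gradient_deriv[OF graph]
  have "Ck_on (Suc k) W (hidden_gradient F)"
    by (rule Ck_on_le[OF Ck_on_gradients(1)[OF open_W F_Ck]]) (use assms in simp)
  then have "Ck_on k U (\<lambda>x. ?G' x v)" for v
    using graph
    by (intro Ck_on_compose[OF open_U open_W Ck_on_Pair[OF open_U Ck_on_ident[OF open_U] assms(1)]
          Ck_on_Suc_derivative]) auto
  then have *: "Ck_on k U (\<lambda>x. ?G' x v $ i)" for v i
    by (rule Ck_on_bounded_linear[OF open_U bounded_linear_vec_nth])
  show ?thesis
  proof (rule Ck_on_linear_solution[OF open_U])
    show "Ck_on k U (\<lambda>x. E_ss F x (g x) $ i $ j)" for i j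
      by (rule Ck_on_cong[OF open_U _ *[of "(0, axis j 1)" i]])
        (simp add: Hessian_blocks(1)[OF G', symmetric] matrix_vector_mult_basis column_def)
    show "Ck_on k U (\<lambda>x. ((- 1) *\<^sub>R ?G' x (h, 0)) $ i)" for i
      using Ck_on_scaleR[OF open_U Ck_on_const[of k U "-1"] *[of "(h, 0)" i]] by simp
    show "invertible (E_ss F x (g x))" if "x \<in> U" for x
      using nondegenerate that .
    show "E_ss F x (g x) *v (- (matrix_inv (E_ss F x (g x)) ** E_sz F x (g x)) *v h) =
        (- 1) *\<^sub>R ?G' x (h, 0)" if "x \<in> U" for x
    proof -
      have "E_ss F x (g x) ** (matrix_inv (E_ss F x (g x)) ** E_sz F x (g x)) = E_sz F x (g x)"
        by (simp add: matrix_mul_assoc matrix_inv_inverts(1)[OF nondegenerate[OF that]])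
      then show ?thesis
        by (simp add: matrix_vector_mul_assoc Hessian_blocks(2)[OF G'[OF that], symmetric]
            matrix_vector_mult_minus)
    qed
  qed
qed

text \<open>Bootstrapping: each order of smoothness of \<open>g\<close> passes to its derivative and so yields the next
  order, until the smoothness of the energy is used up.\<close>

theorem Ck_on_section: "Ck_on r U g"
proof -
  have "Ck_on k U g" if "k \<le> r" for k
    using that
  proof (induction k)
    case (Suc k)
    then show ?case
      by (intro Ck_on_SucI[OF open_U section_has_derivative] Ck_on_section_derivative) auto
  qed (simp add: g_cont)
  then show ?thesis by simp
qed

lemma Ck_on_energy: "Ck_on r U (\<lambda>x. F (x, g x))"
  using graph
  by (intro Ck_on_compose[OF open_U open_W Ck_on_Pair[OF open_U Ck_on_ident[OF open_U] Ck_on_section]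
      Ck_on_SucD[OF F_Ck]]) auto

lemma graph_has_derivative:
  assumes "x \<in> U"
  shows "((\<lambda>x. (x, g x)) has_derivative
    (\<lambda>h. (h, - (matrix_inv (E_ss F x (g x)) ** E_sz F x (g x)) *v h))) (at x)"
  by (intro has_derivative_Pair has_derivative_ident section_has_derivative[OF assms])

text \<open>The contribution of \<open>D g\<close> is a derivative of \<open>F\<close> in a hidden direction, and these vanish at
  critical points.\<close>

theorem envelope_gradient:
  assumes "x \<in> U"
  shows "gradient (\<lambda>x. F (x, g x)) x = E_z F x (g x)"
proof -
  let ?F' = "frechet_derivative F (at (x, g x))"
  let ?J = "- (matrix_inv (E_ss F x (g x)) ** E_sz F x (g x))"
  have F': "(F has_derivative ?F') (at (x, g x))"
    by (rule Ck_on_Suc_has_derivative[OF F_Ck graph[OF assms]])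
  have "gradient (\<lambda>x. F (x, g x)) x $ i = E_z F x (g x) $ i" for i
  proof -
    have "gradient (\<lambda>x. F (x, g x)) x $ i = ?F' (axis i 1, ?J *v axis i 1)"
      by (rule gradient_eq[OF has_derivative_compose[OF graph_has_derivative[OF assms] F']])
    also have "\<dots> = ?F' (axis i 1, 0) + ?F' (0, ?J *v axis i 1)"
      using linear_add[OF has_derivative_linear[OF F'], of "(axis i 1, 0)" "(0, ?J *v axis i 1)"] by simp
    also have "?F' (0, ?J *v axis i 1) = 0"
      by (simp add: derivative_hidden[OF F'] critical[OF assms])
    finally show ?thesis
      using gradient_nth_eq_derivative(2)[OF F'] by (simp add: visible_gradient_def E_z_def)
  qed
  then show ?thesis by (simp add: vec_eq_iff)
qed

text \<open>The gradient formula holds at every point of \<open>U\<close>, so it can be differentiated once more along the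
  graph.\<close>

theorem envelope_hessian:
  assumes "x \<in> U"
  shows "hessian (\<lambda>x. F (x, g x)) x = E_zz F x (g x) -
    E_zs F x (g x) ** matrix_inv (E_ss F x (g x)) ** E_sz F x (g x)"
proof -
  let ?V' = "frechet_derivative (visible_gradient F) (at (x, g x))"
  let ?J = "- (matrix_inv (E_ss F x (g x)) ** E_sz F x (g x))"
  note V' = visible_gradient_deriv[OF graph[OF assms]]
  have C2: "Ck_on 2 W F"
    by (rule Ck_on_le[OF F_Ck]) (use r_pos in simp)
  have "?V' (h, ?J *v h) = (E_zz F x (g x) -
      E_zs F x (g x) ** matrix_inv (E_ss F x (g x)) ** E_sz F x (g x)) *v h" for h
  proof -
    have "?V' (h, ?J *v h) = ?V' (h, 0) + ?V' (0, ?J *v h)"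
      using linear_add[OF has_derivative_linear[OF V'], of "(h, 0)" "(0, ?J *v h)"] by simp
    also have "\<dots> = E_zz F x (g x) *v h + E_zs F x (g x) *v (?J *v h)"
      by (simp only: Hessian_block_zz[OF V'] mixed_Hessian_block[OF open_W C2 graph[OF assms] V'])
    also have "E_zs F x (g x) *v (?J *v h) =
        - ((E_zs F x (g x) ** matrix_inv (E_ss F x (g x)) ** E_sz F x (g x)) *v h)"
      by (simp add: matrix_vector_mult_minus flip: matrix_vector_mul_assoc)
    finally show ?thesis
      by (simp add: matrix_vector_mult_diff_rdistrib)
  qed
  then have "((\<lambda>x. visible_gradient F (x, g x)) has_derivative (\<lambda>h. (E_zz F x (g x) -
      E_zs F x (g x) ** matrix_inv (E_ss F x (g x)) ** E_sz F x (g x)) *v h)) (at x)"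
    using has_derivative_compose[OF graph_has_derivative[OF assms] V'] by simp
  moreover have "visible_gradient F (y, g y) = gradient (\<lambda>x. F (x, g x)) y" if "y \<in> U" for y
    using envelope_gradient[OF that] by (simp add: visible_gradient_def E_z_def)
  ultimately have "(gradient (\<lambda>x. F (x, g x)) has_derivative (\<lambda>h. (E_zz F x (g x) -
      E_zs F x (g x) ** matrix_inv (E_ss F x (g x)) ** E_sz F x (g x)) *v h)) (at x)"
    by (rule has_derivative_transform_within_open[OF _ open_U assms])
  then show ?thesis
    unfolding hessian_def by (rule jacobian_unique)
qed

end

section \<open>Charts\<close>

lemma chart_inv_cancel: "is_chart c \<Longrightarrow> z \<in> fst c \<Longrightarrow> chart_inv c (snd c z) = z"
  by (simp add: is_chart_def homeomorphism_def)

lemma chart_cancel: "x \<in> snd c ` fst c \<Longrightarrow> snd c (chart_inv c x) = x"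
  by (simp add: chart_inv_def f_inv_into_f)

lemma chart_inv_in: "x \<in> snd c ` fst c \<Longrightarrow> chart_inv c x \<in> fst c"
  by (simp add: chart_inv_def inv_into_into)

lemma chart_inv_prod:
  assumes "is_chart c" "is_chart d" "x \<in> snd c ` fst c" "y \<in> snd d ` fst d"
  shows "chart_inv (prod_chart c d) (x, y) = (chart_inv c x, chart_inv d y)"
proof -
  have "inj_on (snd c) (fst c)" "inj_on (snd d) (fst d)"
    by (rule inj_on_inverseI, erule chart_inv_cancel[OF assms(1)],
        rule inj_on_inverseI, erule chart_inv_cancel[OF assms(2)])
  then have "inj_on (map_prod (snd c) (snd d)) (fst c \<times> fst d)"
    by (auto simp: inj_on_def)
  moreover have "(chart_inv c x, chart_inv d y) \<in> fst c \<times> fst d"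
    using assms(3,4) by (simp add: chart_inv_in)
  ultimately have "inv_into (fst c \<times> fst d) (map_prod (snd c) (snd d))
      (map_prod (snd c) (snd d) (chart_inv c x, chart_inv d y)) = (chart_inv c x, chart_inv d y)"
    by (rule inv_into_f_f)
  moreover have "chart_inv (prod_chart c d) = inv_into (fst c \<times> fst d) (map_prod (snd c) (snd d))"
    by (simp only: chart_inv_def prod_chart_def fst_conv snd_conv)
  ultimately show ?thesis
    using assms(3,4) by (simp add: chart_cancel)
qed

lemma open_chart_image:
  assumes "is_chart c" "open V" "V \<subseteq> fst c"
  shows "open (snd c ` V)"
proof -
  have "openin (top_of_set (fst c)) V"
    using assms by (simp add: is_chart_def openin_open_eq)
  then have "openin (top_of_set (snd c ` fst c)) (snd c ` V)"
    using assms(1) homeomorphism_imp_open_map unfolding is_chart_def by metis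
  then show ?thesis
    using assms(1) openin_open_trans unfolding is_chart_def by metis
qed

text \<open>Pulling back a closed ball through a chart shows that a manifold is locally compact, which makes
  inf-compactness applicable near every parameter.\<close>

lemma chart_compact_neighbourhood:
  fixes c :: "('m::topological_space, 'e::euclidean_space) chart"
  assumes "is_chart c" "z \<in> fst c"
  obtains N K where "open N" "z \<in> N" "N \<subseteq> K" "compact K"
proof -
  have op: "open (fst c)" "open (snd c ` fst c)" and cont: "continuous_on (fst c) (snd c)"
    and cont': "continuous_on (snd c ` fst c) (chart_inv c)"
    using assms(1) by (auto simp: is_chart_def homeomorphism_def)
  obtain e where e: "e > 0" "cball (snd c z) e \<subseteq> snd c ` fst c"
    using op(2) assms(2) open_contains_cball by blast
  show thesis
  proof (rule that)
    show "open (fst c \<inter> snd c -` ball (snd c z) e)"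
      using continuous_open_preimage[OF cont op(1) open_ball] .
    show "z \<in> fst c \<inter> snd c -` ball (snd c z) e"
      using assms(2) e(1) by simp
    show "fst c \<inter> snd c -` ball (snd c z) e \<subseteq> chart_inv c ` cball (snd c z) e"
    proof
      fix y assume "y \<in> fst c \<inter> snd c -` ball (snd c z) e"
      then have "y = chart_inv c (snd c y)" "snd c y \<in> cball (snd c z) e"
        using chart_inv_cancel[OF assms(1)] by auto
      then show "y \<in> chart_inv c ` cball (snd c z) e" by (rule image_eqI)
    qed
    show "compact (chart_inv c ` cball (snd c z) e)"
      using compact_continuous_image[OF continuous_on_subset[OF cont' e(2)] compact_cball] .
  qed
qed

section \<open>Continuity of the minimizer\<close>

lemma minimizer_properties:
  fixes E :: "'m \<times> 's \<Rightarrow> real"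
  assumes "\<exists>!s. is_arg_min (\<lambda>s. E (z, s)) (\<lambda>s. True) s"
  shows "E (z, minimizer E z) \<le> E (z, s)"
    and "s \<noteq> minimizer E z \<Longrightarrow> E (z, minimizer E z) < E (z, s)"
proof -
  have min: "is_arg_min (\<lambda>s. E (z, s)) (\<lambda>s. True) (minimizer E z)"
    unfolding minimizer_def arg_min_def by (rule someI_ex[OF ex1_implies_ex[OF assms]])
  then have le: "E (z, minimizer E z) \<le> E (z, s)" for s
    by (simp add: is_arg_min_linorder)
  then show "E (z, minimizer E z) \<le> E (z, s)" .
  show "E (z, minimizer E z) < E (z, s)" if "s \<noteq> minimizer E z"
  proof (rule ccontr)
    assume "\<not> E (z, minimizer E z) < E (z, s)"
    then have "E (z, s) \<le> E (z, t)" for t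
      using le[of t] by linarith
    then have "is_arg_min (\<lambda>s. E (z, s)) (\<lambda>s. True) s"
      by (simp add: is_arg_min_linorder)
    with min assms that show False
      by (elim ex1E) metis
  qed
qed

text \<open>Inf-compactness confines nearby minimizers to a compact set \<open>C\<close>. Uniqueness makes the energy on
  \<open>C - V\<close> strictly larger than at the minimizer, and compactness makes this inequality
  stable under small changes of the parameter.\<close>

lemma continuous_minimizer:
  fixes E :: "'m::t2_space \<times> 's::t2_space \<Rightarrow> real"
  assumes E: "continuous_on UNIV E"
    and compact: "locally_uniformly_inf_compact E"
    and unique: "\<forall>z. \<exists>!s. is_arg_min (\<lambda>s. E (z, s)) (\<lambda>s. True) s"
    and locally_compact: "\<And>z :: 'm. \<exists>N K. open N \<and> z \<in> N \<and> N \<subseteq> K \<and> compact K"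
  shows "continuous_on UNIV (minimizer E)"
proof -
  have "\<exists>U. open U \<and> z0 \<in> U \<and> (\<forall>z\<in>U. minimizer E z \<in> V)"
    if V: "open V" "minimizer E z0 \<in> V" for z0 V
  proof -
    let ?s0 = "minimizer E z0"
    note min = minimizer_properties[OF unique[rule_format]]
    obtain N K where N: "open N" "z0 \<in> N" "N \<subseteq> K" "compact K"
      using locally_compact[of z0] by (elim exE conjE)
    define C where "C = closure {s. \<exists>z\<in>K. E (z, s) \<le> E (z0, ?s0) + 1}"
    have "compact C"
      unfolding C_def
      by (rule compact[unfolded locally_uniformly_inf_compact_def, rule_format, OF N(4)])
    then have CV: "compact (C - V)"
      using V(1) by (rule compact_diff)
    have cont0: "continuous_on UNIV (\<lambda>z. E (z, ?s0))"
      by (rule continuous_on_compose2[OF E continuous_on_Pair[OF continuous_on_id continuous_on_const]]) simp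
    have "continuous_on UNIV (\<lambda>p :: 'm \<times> 's. E (fst p, ?s0))"
      by (rule continuous_on_compose2[OF cont0 continuous_on_fst[OF continuous_on_id]]) simp
    then have "open {p. E (fst p, ?s0) < E p}"
      using E by (rule open_Collect_less)
    moreover have "{z0} \<times> (C - V) \<subseteq> {p. E (fst p, ?s0) < E p}"
    proof
      fix p assume "p \<in> {z0} \<times> (C - V)"
      then have "fst p = z0" "snd p \<notin> V" by auto
      then have "E (z0, ?s0) < E (z0, snd p)"
        using V(2) by (intro min(2)) metis
      then show "p \<in> {p. E (fst p, ?s0) < E p}"
        using \<open>fst p = z0\<close> by (metis (mono_tags) mem_Collect_eq prod.collapse)
    qed
    ultimately have "\<exists>N'. z0 \<in> N' \<and> open N' \<and> N' \<times> (C - V) \<subseteq> {p. E (fst p, ?s0) < E p}"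
      by (rule Elementary_Topology.tube_lemma[OF CV])
    then obtain N' where N': "z0 \<in> N'" "open N'" "N' \<times> (C - V) \<subseteq> {p. E (fst p, ?s0) < E p}"
      by (elim exE conjE)
    define N'' where "N'' = {z. E (z, ?s0) < E (z0, ?s0) + 1}"
    have "open N''"
      unfolding N''_def by (rule open_Collect_less[OF cont0 continuous_on_const])
    then have "open (N \<inter> N' \<inter> N'')"
      using N(1) N'(2) by (intro open_Int)
    moreover have "z0 \<in> N \<inter> N' \<inter> N''"
      using N(2) N'(1) by (simp add: N''_def)
    moreover have "minimizer E z \<in> V" if "z \<in> N" "z \<in> N'" "z \<in> N''" for z
    proof (rule ccontr)
      assume "minimizer E z \<notin> V"
      have "E (z, minimizer E z) \<le> E (z0, ?s0) + 1"
        using min(1)[of z ?s0] that(3) by (simp add: N''_def)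
      then have "minimizer E z \<in> {s. \<exists>z\<in>K. E (z, s) \<le> E (z0, ?s0) + 1}"
        using that(1) N(3) by blast
      then have "minimizer E z \<in> C"
        unfolding C_def by (rule subsetD[OF closure_subset])
      then have "E (z, ?s0) < E (z, minimizer E z)"
        using subsetD[OF N'(3), of "(z, minimizer E z)"] that(2) \<open>minimizer E z \<notin> V\<close> by simp
      then show False using min(1)[of z ?s0] by simp
    qed
    ultimately show ?thesis
      by blast
  qed
  then show ?thesis
    unfolding continuous_on_topological Ball_def by simp
qed

section \<open>Regularity and derivatives of the minimizer\<close>

text \<open>The hidden chart domain is open and contains the minimizer, so the hidden derivative vanishes
  by the first-order condition for an interior minimum.\<close>

lemma local_energy_critical_section:
  fixes c :: "('m::topological_space, real^'z) chart" and d :: "('s::topological_space, real^'n) chart"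
    and E :: "'m \<times> 's \<Rightarrow> real"
  assumes c: "is_chart c" and d: "is_chart d"
    and r: "r \<ge> 1" and E: "Ck_on (Suc r) (snd c ` fst c \<times> snd d ` fst d) (local_rep (prod_chart c d) id_chart E)"
    and unique: "\<forall>z. \<exists>!s. is_arg_min (\<lambda>s. E (z, s)) (\<lambda>s. True) s"
    and cont: "continuous_on UNIV (minimizer E)"
    and pos: "\<And>z. z \<in> fst c \<Longrightarrow> minimizer E z \<in> fst d \<Longrightarrow>
      pos_def (E_ss (local_rep (prod_chart c d) id_chart E) (snd c z) (snd d (minimizer E z)))"
  shows "critical_section (snd c ` fst c \<times> snd d ` fst d) (local_rep (prod_chart c d) id_chart E)
    (snd c ` (fst c \<inter> minimizer E -` fst d)) (local_rep c d (minimizer E)) r"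
proof
  let ?F = "local_rep (prod_chart c d) id_chart E" and ?g = "local_rep c d (minimizer E)"
  let ?X = "snd c ` fst c" and ?Y = "snd d ` fst d"
  let ?V = "fst c \<inter> minimizer E -` fst d"
  have op: "open (fst c)" "open (fst d)" "open ?X" "open ?Y"
    using c d by (auto simp: is_chart_def)
  show "open (?X \<times> ?Y)" using op by (intro open_Times)
  have "open ?V"
    using op cont by (intro open_Int open_vimage)
  then show U: "open (snd c ` ?V)"
    by (rule open_chart_image[OF c]) simp
  show "1 \<le> r" "Ck_on (Suc r) (?X \<times> ?Y) ?F" by (fact r E)+
  have inv: "continuous_on ?X (chart_inv c)" and dc: "continuous_on (fst d) (snd d)"
    using c d by (auto simp: is_chart_def homeomorphism_def)
  have g_at: "?g (snd c z) = snd d (minimizer E z)" if "z \<in> fst c" for z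
    using that by (simp add: local_rep_def chart_inv_cancel[OF c])
  have F_at: "?F (snd c z, y) = E (z, chart_inv d y)" if "z \<in> fst c" "y \<in> ?Y" for z y
    using that by (simp add: local_rep_def id_chart_def chart_inv_prod[OF c d] chart_inv_cancel[OF c])
  have "continuous_on (snd c ` ?V) (\<lambda>x. snd d (minimizer E (chart_inv c x)))"
  proof (rule continuous_on_compose2[OF dc])
    show "continuous_on (snd c ` ?V) (\<lambda>x. minimizer E (chart_inv c x))"
      by (rule continuous_on_compose2[OF cont continuous_on_subset[OF inv]]) auto
    show "(\<lambda>x. minimizer E (chart_inv c x)) ` (snd c ` ?V) \<subseteq> fst d"
      by (auto simp: chart_inv_cancel[OF c])
  qed
  then show "continuous_on (snd c ` ?V) ?g"
    by (simp add: local_rep_def comp_def)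
  fix x assume "x \<in> snd c ` ?V"
  then obtain z where z: "z \<in> fst c" "minimizer E z \<in> fst d" "x = snd c z" by auto
  have gz: "?g x = snd d (minimizer E z)" using z g_at by simp
  show graph: "(x, ?g x) \<in> ?X \<times> ?Y"
    using z gz by auto
  show "invertible (E_ss ?F x (?g x))"
    unfolding gz unfolding z(3) by (rule pos_def_imp_invertible[OF pos[OF z(1,2)]])
  have F': "(?F has_derivative frechet_derivative ?F (at (x, ?g x))) (at (x, ?g x))"
    by (rule Ck_on_Suc_has_derivative[OF E graph])
  have "\<forall>y\<in>?Y. ?F (x, ?g x) \<le> ?F (x, y)"
    using minimizer_properties(1)[OF unique[rule_format]] z
    by (auto simp: g_at F_at chart_inv_cancel[OF d])
  then have "(\<lambda>k. frechet_derivative ?F (at (x, ?g x)) (0, k)) = (\<lambda>k. 0)"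
    using graph by (intro differential_zero_maxmin[OF _ op(4) has_derivative_partial(2)[OF F']]) auto
  then show "hidden_gradient ?F (x, ?g x) = 0"
    by (simp add: vec_eq_iff gradient_nth_eq_derivative(1)[OF F'] fun_eq_iff)
qed

theorem theorem3:
  fixes A :: "('m::{t2_space, second_countable_topology}, real^'z) chart set"
    and B :: "('s::{t2_space, second_countable_topology}, real^'n) chart set"
    and E :: "'m \<times> 's \<Rightarrow> real"
    and r :: nat
  assumes "smooth_atlas A" and "smooth_atlas B"
    and "r \<ge> 2"
    and "Ck_map (r + 1) (prod_atlas A B) {id_chart} E"
    and "locally_uniformly_inf_compact E"
    and "\<forall>z. \<exists>!s. is_arg_min (\<lambda>s. E (z, s)) (\<lambda>s. True) s"
    and "\<forall>c\<in>A. \<forall>d\<in>B. \<forall>z. z \<in> fst c \<and> minimizer E z \<in> fst d \<longrightarrow>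
           pos_def (E_ss (local_rep (prod_chart c d) id_chart E) (snd c z) (snd d (minimizer E z)))"
  shows "Ck_map r A B (minimizer E) \<and>
    Ck_map r A {id_chart} (reduced_energy E) \<and>
    (\<forall>c\<in>A. \<forall>d\<in>B. \<forall>z. z \<in> fst c \<and> minimizer E z \<in> fst d \<longrightarrow>
      (let F = local_rep (prod_chart c d) id_chart E;
           x = snd c z;
           y = snd d (minimizer E z);
           H = E_ss F x y;
           e = local_rep c id_chart (reduced_energy E)
       in jacobian (local_rep c d (minimizer E)) (at x) = - (matrix_inv H ** E_sz F x y) \<and>
          gradient e x = E_z F x y \<and>
          hessian e x = E_zz F x y - E_zs F x y ** matrix_inv H ** E_sz F x y \<and>
          (\<forall>(p :: 'a::finite \<Rightarrow> 'n) (q :: 'b::finite \<Rightarrow> 'n). bij (case_sum p q) \<longrightarrow>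
            (let HH = full_hessian F x y;
                 \<alpha> = Inr \<circ> p;
                 \<beta> = Inr \<circ> q;
                 \<alpha>\<beta> = case_sum \<alpha> \<beta>
             in pos_def (block \<alpha>\<beta> \<alpha>\<beta> HH) \<longrightarrow>
                schur Inl \<alpha>\<beta> HH = schur Inl Inr (schur (case_sum Inl \<alpha>) \<beta> HH)))))"
proof -
  note A = \<open>smooth_atlas A\<close> and B = \<open>smooth_atlas B\<close>
  have chart_A: "is_chart c" if "c \<in> A" for c using A that by (simp add: smooth_atlas_def)
  have chart_B: "is_chart d" if "d \<in> B" for d using B that by (simp add: smooth_atlas_def)
  have cover_A: "\<exists>c\<in>A. z \<in> fst c" for z :: 'm using A by (auto simp: smooth_atlas_def)
  have cover_B: "\<exists>d\<in>B. s \<in> fst d" for s :: 's using B by (auto simp: smooth_atlas_def)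
  have E_cont: "continuous_on UNIV E" using assms(4) by (simp add: Ck_map_def)
  have cont: "continuous_on UNIV (minimizer E)"
  proof (rule continuous_minimizer[OF E_cont assms(5,6)])
    show "\<exists>N K. open N \<and> z \<in> N \<and> N \<subseteq> K \<and> compact K" for z :: 'm
      using cover_A[of z] chart_compact_neighbourhood[OF chart_A] by metis
  qed
  have E_Ck: "Ck_on (Suc r) (snd c ` fst c \<times> snd d ` fst d) (local_rep (prod_chart c d) id_chart E)"
    if "c \<in> A" "d \<in> B" for c d
  proof -
    have "prod_chart c d \<in> prod_atlas A B" using that unfolding prod_atlas_def by blast
    then have "Ck_on (r + 1) (snd (prod_chart c d) ` (fst (prod_chart c d) \<inter> E -` fst id_chart))
        (local_rep (prod_chart c d) id_chart E)"
      using assms(4) unfolding Ck_map_def by blast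
    moreover have "snd (prod_chart c d) ` (fst (prod_chart c d) \<inter> E -` fst id_chart) =
        snd c ` fst c \<times> snd d ` fst d"
      by (simp add: prod_chart_def id_chart_def map_prod_surj_on)
    ultimately show ?thesis by (simp only: Suc_eq_plus1)
  qed
  have crit: "critical_section (snd c ` fst c \<times> snd d ` fst d) (local_rep (prod_chart c d) id_chart E)
      (snd c ` (fst c \<inter> minimizer E -` fst d)) (local_rep c d (minimizer E)) r"
    if "c \<in> A" "d \<in> B" for c d
    using assms(3,7) that
    by (intro local_energy_critical_section[OF chart_A chart_B _ E_Ck assms(6) cont]) auto
  have energy: "local_rep (prod_chart c d) id_chart E (x, local_rep c d (minimizer E) x) =
      local_rep c id_chart (reduced_energy E) x"
    if "c \<in> A" "d \<in> B" "x \<in> snd c ` (fst c \<inter> minimizer E -` fst d)" for c d x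
    using that
    by (auto simp: local_rep_def id_chart_def reduced_energy_def chart_inv_prod[OF chart_A chart_B]
        chart_inv_cancel[OF chart_A] chart_inv_cancel[OF chart_B])
  have "Ck_map r A B (minimizer E)"
    using cont critical_section.Ck_on_section[OF crit] by (simp add: Ck_map_def)
  moreover have "Ck_map r A {id_chart} (reduced_energy E)"
    unfolding Ck_map_def
  proof (intro conjI ballI)
    show "continuous_on UNIV (reduced_energy E)"
      unfolding reduced_energy_def
      by (intro continuous_on_compose2[OF E_cont] continuous_on_Pair continuous_on_id cont) auto
    fix c :: "('m, real^'z) chart" and i :: "(real, real) chart"
    assume c: "c \<in> A" and "i \<in> {id_chart}"
    then have i: "i = id_chart" by simp
    show "Ck_on r (snd c ` (fst c \<inter> reduced_energy E -` fst i)) (local_rep c i (reduced_energy E))"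
      unfolding i
    proof (rule Ck_on_locally)
      fix x assume "x \<in> snd c ` (fst c \<inter> reduced_energy E -` fst id_chart)"
      then obtain z where z: "z \<in> fst c" "x = snd c z" by auto
      obtain d where d: "d \<in> B" "minimizer E z \<in> fst d" using cover_B by blast
      let ?U = "snd c ` (fst c \<inter> minimizer E -` fst d)"
      interpret critical_section "snd c ` fst c \<times> snd d ` fst d" "local_rep (prod_chart c d) id_chart E"
        ?U "local_rep c d (minimizer E)" r
        by (rule crit[OF c d(1)])
      have "Ck_on r ?U (local_rep c id_chart (reduced_energy E))"
        by (rule Ck_on_cong[OF open_U energy[OF c d(1)] Ck_on_energy])
      then show "\<exists>T. open T \<and> x \<in> T \<and> Ck_on r T (local_rep c id_chart (reduced_energy E))"
        using open_U z d by blast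
    qed
  qed
  moreover have "jacobian (local_rep c d (minimizer E)) (at x) = - (matrix_inv (E_ss F x y) ** E_sz F x y) \<and>
      gradient e x = E_z F x y \<and>
      hessian e x = E_zz F x y - E_zs F x y ** matrix_inv (E_ss F x y) ** E_sz F x y"
    if "c \<in> A" "d \<in> B" "z \<in> fst c" "minimizer E z \<in> fst d"
      and F_eq: "F = local_rep (prod_chart c d) id_chart E" and x: "x = snd c z"
      and y: "y = snd d (minimizer E z)" and e: "e = local_rep c id_chart (reduced_energy E)"
    for c d z F x y e
  proof -
    let ?U = "snd c ` (fst c \<inter> minimizer E -` fst d)"
    interpret critical_section "snd c ` fst c \<times> snd d ` fst d" F ?U "local_rep c d (minimizer E)" r
      unfolding F_eq by (rule crit[OF that(1,2)])
    have xU: "x \<in> ?U" using that by blast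
    have g: "local_rep c d (minimizer E) x = y"
      using that(3) by (simp add: x y local_rep_def chart_inv_cancel[OF chart_A[OF that(1)]])
    have e_eq: "e w = F (w, local_rep c d (minimizer E) w)" if "w \<in> ?U" for w
      using energy[OF \<open>c \<in> A\<close> \<open>d \<in> B\<close> that] by (simp add: e F_eq)
    show ?thesis
      using jacobian_unique[OF section_has_derivative[OF xU]]
        gradient_cong_open[OF open_U xU e_eq] envelope_gradient[OF xU]
        hessian_cong_open[OF open_U xU e_eq] envelope_hessian[OF xU]
      by (simp add: g)
  qed
  moreover have "schur Inl (case_sum (Inr \<circ> p) (Inr \<circ> q)) M =
      schur Inl Inr (schur (case_sum Inl (Inr \<circ> p)) (Inr \<circ> q) M)"
    if "pos_def (block (case_sum (Inr \<circ> p) (Inr \<circ> q)) (case_sum (Inr \<circ> p) (Inr \<circ> q)) M)"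
    for p :: "'a \<Rightarrow> 'n" and q :: "'b \<Rightarrow> 'n" and M :: "real^('z + 'n)^('z + 'n)"
    using that by (rule schur_sequential)
  ultimately show ?thesis
    unfolding Let_def by blast
qed

end
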